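(* Let $(M,g)=(B\times_f F,\ g_B\oplus f^2 g_F)$ be a warped product of two Riemannian manifolds $(B,g_B)$ and $(F,g_F)$ with warping function $f$, $\dim B=m$ and $\dim F=n$. Let $(M,g,\mu,\xi)$ be a conformal Ricci soliton with concurrent vector field $\xi$. If $f$ is constant and both $\xi_B$ and $\xi_F$ are concurrent on the base $B$ and the fiber $F$ respectively, then: (1) the soliton $(M,g,\mu,\xi)$ is expanding, steady or shrinking according as $(\frac p2+\frac1n+1)<0$, $(\frac p2+\frac1n+1)=0$ or $(\frac p2+\frac1n+1)>0$ respectively; (2) all the three manifolds $M$, $B$ and $F$ are Ricci flat manifolds; and (3) all the three manifolds $M$, $B$ and $F$ admit conformal gradient Ricci solitons.
   Context: Warped product: for Riemannian manifolds $(B,g_B)$ (base) and $(F,g_F)$ (fiber) and a positive smooth function $f$ on $B$ (warping function), $M=B\times_f F$ is the product manifold $B\times F$ with metric $g=\pi^*g_B+(f\circ\pi)^2\sigma^*g_F$, where $\pi,\sigma$ are the projections onto $B$ and $F$; this metric is also written $g_B\oplus f^2g_F$. Conformal Ricci soliton: $(M,g,\mu,\xi)$ is a conformal Ricci soliton if $\mathcal{L}_\xi g+2\,Ric=\mu g$, where $\xi$ is a smooth vector field on $M$ and $\mu=2\lambda-(p+\frac2n)$ (with $n=\dim F$), $\lambda$ being a real constant (soliton constant) and $p$ a scalar field (conformal pressure). The soliton is expanding if $\lambda<0$, steady if $\lambda=0$, and shrinking if $\lambda>0$. A Riemannian manifold $(N,h)$ admits a conformal gradient Ricci soliton if there are a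 smooth function $\psi$ on $N$ and a scalar $\nu$ with $2H^\psi+2\,Ric_h=\nu h$, i.e. $\mathcal{L}_{\mathrm{grad}\,\psi}h+2Ric_h=\nu h$, where $H^\psi$ is the Hessian of $\psi$. Vector field convention: $\xi=\xi_B+\xi_F$, where $\xi_B$ and $\xi_F$ are (lifts to $M$ of) vector fields on $B$ and on $F$ respectively. A vector field $\zeta$ on a Riemannian manifold $(N,h)$ is concurrent if $\nabla_X\zeta=X$ for all vector fields $X$ on $N$, with $\nabla$ the Levi-Civita connection of $h$. *)

theory Defs
  imports "HOL-Analysis.Analysis"
begin

section \<open>Smooth maps between Euclidean spaces\<close>

primrec Ck_on :: "nat \<Rightarrow> 'e::euclidean_space set \<Rightarrow> ('e \<Rightarrow> 'b::real_normed_vector) \<Rightarrow> bool" where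
  "Ck_on 0 S h \<longleftrightarrow> continuous_on S h"
| "Ck_on (Suc k) S h \<longleftrightarrow>
     (\<forall>u\<in>S. h differentiable (at u)) \<and> (\<forall>v. Ck_on k S (\<lambda>u. frechet_derivative h (at u) v))"

text \<open>Only meaningful for open \<open>S\<close>, since the derivatives are taken on full neighbourhoods.\<close>

definition smooth_on :: "'e::euclidean_space set \<Rightarrow> ('e \<Rightarrow> 'b::real_normed_vector) \<Rightarrow> bool" where
  "smooth_on S h \<longleftrightarrow> (\<forall>k. Ck_on k S h)"


section \<open>Riemannian geometry in one coordinate chart\<close>

text \<open>
  Here \<open>G u\<close> is the matrix of a metric at the coordinate point \<open>u\<close>, as a bilinear form on the model
  space \<open>'e\<close>, and a local vector field is its component function \<open>'e \<Rightarrow> 'e\<close>.  A constant function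
  \<open>\<lambda>_. v\<close> is a constant-coefficient combination of coordinate vector fields; such fields commute.
\<close>

text \<open>The metric is nondegenerate, so the Koszul formula on coordinate fields determines the
  vector of Christoffel symbols \<open>\<nabla>\<^sub>v w\<close> uniquely.\<close>

definition loc_christoffel ::
    "('e::euclidean_space \<Rightarrow> 'e \<Rightarrow> 'e \<Rightarrow> real) \<Rightarrow> 'e \<Rightarrow> 'e \<Rightarrow> 'e \<Rightarrow> 'e" where
  "loc_christoffel G u v w = (THE z. \<forall>y. 2 * G u z y =
       frechet_derivative (\<lambda>a. G a w y) (at u) v
     + frechet_derivative (\<lambda>a. G a v y) (at u) w
     - frechet_derivative (\<lambda>a. G a v w) (at u) y)"

definition loc_nabla ::
    "('e::euclidean_space \<Rightarrow> 'e \<Rightarrow> 'e \<Rightarrow> real) \<Rightarrow> ('e \<Rightarrow> 'e) \<Rightarrow> ('e \<Rightarrow> 'e) \<Rightarrow> 'e \<Rightarrow> 'e" where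
  "loc_nabla G X Y u =
     frechet_derivative Y (at u) (X u) + loc_christoffel G u (X u) (Y u)"

definition loc_bracket :: "('e::euclidean_space \<Rightarrow> 'e) \<Rightarrow> ('e \<Rightarrow> 'e) \<Rightarrow> 'e \<Rightarrow> 'e" where
  "loc_bracket X Y u = frechet_derivative Y (at u) (X u) - frechet_derivative X (at u) (Y u)"

text \<open>The value \<open>R(v, w) z\<close> of \<open>R(X, Y) Z = \<nabla>\<^sub>X \<nabla>\<^sub>Y Z - \<nabla>\<^sub>Y \<nabla>\<^sub>X Z - \<nabla>\<^bsub>[X, Y]\<^esub> Z\<close>, which is tensorial,
  computed on the constant extensions of \<open>v\<close>, \<open>w\<close>, \<open>z\<close>; their bracket vanishes.\<close>

definition loc_riemann ::
    "('e::euclidean_space \<Rightarrow> 'e \<Rightarrow> 'e \<Rightarrow> real) \<Rightarrow> 'e \<Rightarrow> 'e \<Rightarrow> 'e \<Rightarrow> 'e \<Rightarrow> 'e" where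
  "loc_riemann G u v w z =
     loc_nabla G (\<lambda>_. v) (loc_nabla G (\<lambda>_. w) (\<lambda>_. z)) u
   - loc_nabla G (\<lambda>_. w) (loc_nabla G (\<lambda>_. v) (\<lambda>_. z)) u"

text \<open>\<open>Ric(v, w)\<close> is the trace of \<open>b \<mapsto> R(b, v) w\<close>.\<close>

definition loc_ricci ::
    "('e::euclidean_space \<Rightarrow> 'e \<Rightarrow> 'e \<Rightarrow> real) \<Rightarrow> 'e \<Rightarrow> 'e \<Rightarrow> 'e \<Rightarrow> real" where
  "loc_ricci G u v w = (\<Sum>b\<in>Basis. loc_riemann G u b v w \<bullet> b)"

text \<open>\<open>(\<L>\<^sub>X g)(Y, Z) = X(g(Y, Z)) - g([X, Y], Z) - g(Y, [X, Z])\<close> on constant extensions.\<close>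

definition loc_lie_metric ::
    "('e::euclidean_space \<Rightarrow> 'e \<Rightarrow> 'e \<Rightarrow> real) \<Rightarrow> ('e \<Rightarrow> 'e) \<Rightarrow> 'e \<Rightarrow> 'e \<Rightarrow> 'e \<Rightarrow> real" where
  "loc_lie_metric G X u v w =
     frechet_derivative (\<lambda>a. G a v w) (at u) (X u)
   - G u (loc_bracket X (\<lambda>_. v) u) w
   - G u v (loc_bracket X (\<lambda>_. w) u)"

text \<open>\<open>H\<^sup>\<psi>(X, Y) = X(Y \<psi>) - (\<nabla>\<^sub>X Y) \<psi>\<close> on constant extensions.\<close>

definition loc_hessian ::
    "('e::euclidean_space \<Rightarrow> 'e \<Rightarrow> 'e \<Rightarrow> real) \<Rightarrow> ('e \<Rightarrow> real) \<Rightarrow> 'e \<Rightarrow> 'e \<Rightarrow> 'e \<Rightarrow> real" where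
  "loc_hessian G h u v w =
     frechet_derivative (\<lambda>a. frechet_derivative h (at a) w) (at u) v
   - frechet_derivative h (at u) (loc_nabla G (\<lambda>_. v) (\<lambda>_. w) u)"


section \<open>Smooth manifolds\<close>

record ('a, 'e) chart =
  cdom :: "'a set"
  cmap :: "'a \<Rightarrow> 'e"
  cinv :: "'e \<Rightarrow> 'a"

definition cimg :: "('a, 'e) chart \<Rightarrow> 'e set" where
  "cimg c = cmap c ` cdom c"

definition is_chart :: "('a::topological_space, 'e::euclidean_space) chart \<Rightarrow> bool" where
  "is_chart c \<longleftrightarrow> open (cdom c) \<and> open (cimg c)
     \<and> homeomorphism (cdom c) (cimg c) (cmap c) (cinv c)"

text \<open>
  Besides an atlas (not necessarily maximal) a manifold carries a preferred chart of the atlas around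
  each point.  The tangent space at \<open>x\<close> is the model space \<open>'e\<close>, a vector being given by its
  components in the preferred chart at \<open>x\<close>.  The choice is arbitrary and need not depend continuously
  on \<open>x\<close>; it only serves to represent vectors, and smoothness is always tested in charts.
\<close>

record ('a, 'e) manifold =
  atlas :: "('a, 'e) chart set"
  chart_at :: "'a \<Rightarrow> ('a, 'e) chart"

definition points :: "('a, 'e) manifold \<Rightarrow> 'a set" where
  "points M = (\<Union>c\<in>atlas M. cdom c)"

definition smooth_manifold ::
    "('a::{t2_space, second_countable_topology}, 'e::euclidean_space) manifold \<Rightarrow> bool" where
  "smooth_manifold M \<longleftrightarrow>
     points M \<noteq> {}
   \<and> (\<forall>c\<in>atlas M. is_chart c)
   \<and> (\<forall>c\<in>atlas M. \<forall>d\<in>atlas M. smooth_on (cmap c ` (cdom c \<inter> cdom d)) (cmap d \<circ> cinv c))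
   \<and> (\<forall>x\<in>points M. chart_at M x \<in> atlas M \<and> x \<in> cdom (chart_at M x))"

text \<open>Components in \<open>c\<close> of a tangent vector at \<open>x\<close>, and the tangent vector at \<open>x\<close> with given
  components in \<open>c\<close>.\<close>

definition to_chart :: "('a, 'e::euclidean_space) manifold \<Rightarrow> ('a, 'e) chart \<Rightarrow> 'a \<Rightarrow> 'e \<Rightarrow> 'e" where
  "to_chart M c x =
     frechet_derivative (cmap c \<circ> cinv (chart_at M x)) (at (cmap (chart_at M x) x))"

definition from_chart :: "('a, 'e::euclidean_space) manifold \<Rightarrow> ('a, 'e) chart \<Rightarrow> 'a \<Rightarrow> 'e \<Rightarrow> 'e" where
  "from_chart M c x =
     frechet_derivative (cmap (chart_at M x) \<circ> cinv c) (at (cmap c x))"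

definition smooth_function :: "('a, 'e::euclidean_space) manifold \<Rightarrow> ('a \<Rightarrow> real) \<Rightarrow> bool" where
  "smooth_function M h \<longleftrightarrow> (\<forall>c\<in>atlas M. smooth_on (cimg c) (h \<circ> cinv c))"

definition vf_in ::
    "('a, 'e::euclidean_space) manifold \<Rightarrow> ('a, 'e) chart \<Rightarrow> ('a \<Rightarrow> 'e) \<Rightarrow> 'e \<Rightarrow> 'e" where
  "vf_in M c X u = to_chart M c (cinv c u) (X (cinv c u))"

definition smooth_vector_field :: "('a, 'e::euclidean_space) manifold \<Rightarrow> ('a \<Rightarrow> 'e) \<Rightarrow> bool" where
  "smooth_vector_field M X \<longleftrightarrow> (\<forall>c\<in>atlas M. smooth_on (cimg c) (vf_in M c X))"

definition metric_in ::
    "('a, 'e::euclidean_space) manifold \<Rightarrow> ('a, 'e) chart \<Rightarrow> ('a \<Rightarrow> 'e \<Rightarrow> 'e \<Rightarrow> real)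
       \<Rightarrow> 'e \<Rightarrow> 'e \<Rightarrow> 'e \<Rightarrow> real" where
  "metric_in M c g u v w =
     g (cinv c u) (from_chart M c (cinv c u) v) (from_chart M c (cinv c u) w)"

definition riemannian_metric ::
    "('a, 'e::euclidean_space) manifold \<Rightarrow> ('a \<Rightarrow> 'e \<Rightarrow> 'e \<Rightarrow> real) \<Rightarrow> bool" where
  "riemannian_metric M g \<longleftrightarrow>
     (\<forall>x\<in>points M. bilinear (g x) \<and> (\<forall>v w. g x v w = g x w v) \<and> (\<forall>v. v \<noteq> 0 \<longrightarrow> g x v v > 0))
   \<and> (\<forall>c\<in>atlas M. \<forall>v w. smooth_on (cimg c) (\<lambda>u. metric_in M c g u v w))"

definition riemannian_manifold ::
    "('a::{t2_space, second_countable_topology}, 'e::euclidean_space) manifold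
       \<Rightarrow> ('a \<Rightarrow> 'e \<Rightarrow> 'e \<Rightarrow> real) \<Rightarrow> bool" where
  "riemannian_manifold M g \<longleftrightarrow> smooth_manifold M \<and> riemannian_metric M g"


section \<open>Covariant derivative, Ricci tensor, Lie derivative and Hessian\<close>

text \<open>
  At \<open>x\<close> the local expressions are evaluated in the preferred chart at \<open>x\<close>, in which the components of
  a tangent vector at \<open>x\<close> are the vector itself.  Being tensorial, the results do not depend on the
  choice of that chart.
\<close>

definition nabla ::
    "('a, 'e::euclidean_space) manifold \<Rightarrow> ('a \<Rightarrow> 'e \<Rightarrow> 'e \<Rightarrow> real)
       \<Rightarrow> ('a \<Rightarrow> 'e) \<Rightarrow> ('a \<Rightarrow> 'e) \<Rightarrow> 'a \<Rightarrow> 'e" where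
  "nabla M g X Y x = (let c = chart_at M x in
     loc_nabla (metric_in M c g) (vf_in M c X) (vf_in M c Y) (cmap c x))"

definition ricci ::
    "('a, 'e::euclidean_space) manifold \<Rightarrow> ('a \<Rightarrow> 'e \<Rightarrow> 'e \<Rightarrow> real) \<Rightarrow> 'a \<Rightarrow> 'e \<Rightarrow> 'e \<Rightarrow> real" where
  "ricci M g x v w = (let c = chart_at M x in loc_ricci (metric_in M c g) (cmap c x) v w)"

definition lie_metric ::
    "('a, 'e::euclidean_space) manifold \<Rightarrow> ('a \<Rightarrow> 'e \<Rightarrow> 'e \<Rightarrow> real)
       \<Rightarrow> ('a \<Rightarrow> 'e) \<Rightarrow> 'a \<Rightarrow> 'e \<Rightarrow> 'e \<Rightarrow> real" where
  "lie_metric M g X x v w = (let c = chart_at M x in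
     loc_lie_metric (metric_in M c g) (vf_in M c X) (cmap c x) v w)"

definition hessian ::
    "('a, 'e::euclidean_space) manifold \<Rightarrow> ('a \<Rightarrow> 'e \<Rightarrow> 'e \<Rightarrow> real)
       \<Rightarrow> ('a \<Rightarrow> real) \<Rightarrow> 'a \<Rightarrow> 'e \<Rightarrow> 'e \<Rightarrow> real" where
  "hessian M g h x v w = (let c = chart_at M x in
     loc_hessian (metric_in M c g) (h \<circ> cinv c) (cmap c x) v w)"

definition ricci_flat ::
    "('a, 'e::euclidean_space) manifold \<Rightarrow> ('a \<Rightarrow> 'e \<Rightarrow> 'e \<Rightarrow> real) \<Rightarrow> bool" where
  "ricci_flat M g \<longleftrightarrow> (\<forall>x\<in>points M. \<forall>v w. ricci M g x v w = 0)"

definition concurrent ::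
    "('a, 'e::euclidean_space) manifold \<Rightarrow> ('a \<Rightarrow> 'e \<Rightarrow> 'e \<Rightarrow> real) \<Rightarrow> ('a \<Rightarrow> 'e) \<Rightarrow> bool" where
  "concurrent M g \<zeta> \<longleftrightarrow> smooth_vector_field M \<zeta>
     \<and> (\<forall>X. smooth_vector_field M X \<longrightarrow> (\<forall>x\<in>points M. nabla M g X \<zeta> x = X x))"


section \<open>Conformal Ricci solitons\<close>

definition conformal_ricci_soliton ::
    "('a, 'e::euclidean_space) manifold \<Rightarrow> ('a \<Rightarrow> 'e \<Rightarrow> 'e \<Rightarrow> real)
       \<Rightarrow> ('a \<Rightarrow> real) \<Rightarrow> ('a \<Rightarrow> 'e) \<Rightarrow> bool" where
  "conformal_ricci_soliton M g \<mu> \<xi> \<longleftrightarrow> smooth_vector_field M \<xi>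
     \<and> (\<forall>x\<in>points M. \<forall>v w. lie_metric M g \<xi> x v w + 2 * ricci M g x v w = \<mu> x * g x v w)"

text \<open>The scalar \<open>\<mu>\<close> for soliton constant \<open>l\<close> and conformal pressure \<open>p\<close>; \<open>n\<close> is the dimension of the
  fiber, not of the whole manifold.\<close>

definition soliton_scalar :: "nat \<Rightarrow> real \<Rightarrow> ('a \<Rightarrow> real) \<Rightarrow> 'a \<Rightarrow> real" where
  "soliton_scalar n l p x = 2 * l - (p x + 2 / real n)"

definition expanding :: "real \<Rightarrow> bool" where "expanding l \<longleftrightarrow> l < 0"
definition steady :: "real \<Rightarrow> bool" where "steady l \<longleftrightarrow> l = 0"
definition shrinking :: "real \<Rightarrow> bool" where "shrinking l \<longleftrightarrow> l > 0"

definition admits_conformal_gradient_ricci_soliton ::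
    "('a, 'e::euclidean_space) manifold \<Rightarrow> ('a \<Rightarrow> 'e \<Rightarrow> 'e \<Rightarrow> real) \<Rightarrow> bool" where
  "admits_conformal_gradient_ricci_soliton N h \<longleftrightarrow>
     (\<exists>(\<psi> :: 'a \<Rightarrow> real) (\<nu> :: real). smooth_function N \<psi>
        \<and> (\<forall>x\<in>points N. \<forall>v w. 2 * hessian N h \<psi> x v w + 2 * ricci N h x v w = \<nu> * h x v w))"


section \<open>Warped products\<close>

definition prod_chart :: "('a, 'e) chart \<Rightarrow> ('b, 'f) chart \<Rightarrow> ('a \<times> 'b, 'e \<times> 'f) chart" where
  "prod_chart c d =
     \<lparr>cdom = cdom c \<times> cdom d, cmap = map_prod (cmap c) (cmap d), cinv = map_prod (cinv c) (cinv d)\<rparr>"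

text \<open>With the product of the preferred charts, the tangent space at \<open>(x, y)\<close> is literally the product
  of the tangent spaces at \<open>x\<close> and \<open>y\<close>, and the differentials of the projections are \<open>fst\<close> and \<open>snd\<close>.\<close>

definition prod_manifold ::
    "('a, 'e) manifold \<Rightarrow> ('b, 'f) manifold \<Rightarrow> ('a \<times> 'b, 'e \<times> 'f) manifold" where
  "prod_manifold B F =
     \<lparr>atlas = {prod_chart c d | c d. c \<in> atlas B \<and> d \<in> atlas F},
      chart_at = (\<lambda>z. prod_chart (chart_at B (fst z)) (chart_at F (snd z)))\<rparr>"

definition warped_metric ::
    "('a \<Rightarrow> 'e \<Rightarrow> 'e \<Rightarrow> real) \<Rightarrow> ('a \<Rightarrow> real) \<Rightarrow> ('b \<Rightarrow> 'f \<Rightarrow> 'f \<Rightarrow> real)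
       \<Rightarrow> 'a \<times> 'b \<Rightarrow> 'e \<times> 'f \<Rightarrow> 'e \<times> 'f \<Rightarrow> real" where
  "warped_metric gB f gF z v w =
     gB (fst z) (fst v) (fst w) + (f (fst z))\<^sup>2 * gF (snd z) (snd v) (snd w)"

definition warping_function :: "('a, 'e::euclidean_space) manifold \<Rightarrow> ('a \<Rightarrow> real) \<Rightarrow> bool" where
  "warping_function B f \<longleftrightarrow> smooth_function B f \<and> (\<forall>x\<in>points B. f x > 0)"

definition lift_base :: "('a \<Rightarrow> 'e) \<Rightarrow> 'a \<times> 'b \<Rightarrow> 'e \<times> 'f::zero" where
  "lift_base X z = (X (fst z), 0)"

definition lift_fiber :: "('b \<Rightarrow> 'f) \<Rightarrow> 'a \<times> 'b \<Rightarrow> 'e::zero \<times> 'f" where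
  "lift_fiber Y z = (0, Y (snd z))"

end

theory Submission
  imports Defs
begin

text \<open>
  A concurrent field \<open>\<zeta>\<close> on a Riemannian manifold \<open>(N, h)\<close> has \<open>L\<^sub>\<zeta> h = 2 h\<close>, since
  \<open>(L\<^sub>\<zeta> h)(v, w) = h(\<nabla>\<^sub>v \<zeta>, w) + h(v, \<nabla>\<^sub>w \<zeta>)\<close>, and it is annihilated by the curvature,
  \<open>R(v, w) \<zeta> = \<nabla>\<^sub>v w - \<nabla>\<^sub>w v - [v, w] = 0\<close>, so that \<open>Ric(v, \<zeta>) = 0\<close>.  If \<open>\<zeta>\<close> is moreover the field of a soliton
  with scalar \<open>\<mu>\<close>, then \<open>Ric = (\<mu>/2 - 1) h\<close>.  Evaluated on \<open>(\<zeta>, \<zeta>)\<close> this gives \<open>\<mu> = 2\<close> wherever \<open>\<zeta>\<close> is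
  nonzero.  Such points are dense, because a field vanishing on an open set has \<open>\<nabla>\<zeta> = 0\<close> there; hence \<open>\<mu> = 2\<close>
  and \<open>Ric = 0\<close> everywhere (\<open>concurrent_soliton\<close>).  On \<open>M\<close> the equation \<open>\<mu> = 2\<close> reads \<open>l = p/2 + 1/n + 1\<close>, which is
  the first claim.

  For constant \<open>f\<close> the Ricci tensor of \<open>M\<close> is the sum of those of \<open>B\<close> and \<open>F\<close> (\<open>ricci_product\<close>), and the concurrent
  fields of the two factors separate the summands.  Ricci-flat manifolds admit conformal gradient Ricci
  solitons with constant potential.

  Two points need more than the formal calculation.  Concurrency is a condition on global vector fields; to
  get \<open>\<nabla>\<^sub>v \<zeta> = v\<close> for a single tangent vector, \<open>v\<close> is extended by a bump function
  (\<open>smooth_vector_field_through\<close>).  And the covariant derivative at a point is evaluated in the preferred chart of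
  that point, while the curvature requires \<open>\<nabla>\<zeta> = id\<close> on a whole chart; the passage is the
  transformation law of the Christoffel symbols (\<open>loc_concurrent_transform\<close>).
\<close>

section \<open>Calculus of smooth maps\<close>

lemma frechet_derivative_eqI:
  "(h has_derivative h') (at u) \<Longrightarrow> frechet_derivative h (at u) = h'"
  using frechet_derivative_at by metis

lemma differentiable_has_derivative:
  "h differentiable (at u) \<Longrightarrow> (h has_derivative frechet_derivative h (at u)) (at u)"
  using frechet_derivative_works by blast

lemma linear_frechet_derivative: "h differentiable (at u) \<Longrightarrow> linear (frechet_derivative h (at u))"
  using differentiable_has_derivative has_derivative_linear by blast

lemma differentiable_transform_open:
  assumes "open S" "u \<in> S" "\<And>a. a \<in> S \<Longrightarrow> h a = k a" "h differentiable (at u)"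
  shows "k differentiable (at u)"
  using assms by (meson differentiable_def has_derivative_transform_within_open)

text \<open>\<^const>\<open>Ck_on\<close> differentiates in fixed directions only; the chain rule produces a moving direction,
  which this expansion reduces to the fixed ones.\<close>

lemma frechet_derivative_expand:
  fixes h :: "'e::euclidean_space \<Rightarrow> 'b::real_normed_vector"
  assumes "h differentiable (at u)"
  shows "frechet_derivative h (at u) x = (\<Sum>b\<in>Basis. (x \<bullet> b) *\<^sub>R frechet_derivative h (at u) b)"
proof -
  interpret L: linear "frechet_derivative h (at u)" by (rule linear_frechet_derivative[OF assms])
  show ?thesis
    by (subst euclidean_representation[of x, symmetric]) (simp only: L.sum L.scaleR)
qed

lemma Ck_on_cong:
  assumes "open S" "\<And>u. u \<in> S \<Longrightarrow> h u = k u" "Ck_on n S h"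
  shows "Ck_on n S k"
  using assms(2,3)
proof (induction n arbitrary: h k)
  case 0
  then show ?case by (simp cong: continuous_on_cong)
next
  case (Suc n)
  have d: "h differentiable (at u)" if "u \<in> S" for u using Suc.prems that by simp
  show ?case
    unfolding Ck_on.simps
  proof (intro conjI ballI allI)
    show "k differentiable (at u)" if "u \<in> S" for u
      using differentiable_transform_open[OF assms(1) that] Suc.prems(1) d[OF that] by blast
    fix v
    have "frechet_derivative h (at u) v = frechet_derivative k (at u) v" if "u \<in> S" for u
      using frechet_derivative_transform_within_open[OF d[OF that] assms(1) that] Suc.prems(1) by metis
    then show "Ck_on n S (\<lambda>u. frechet_derivative k (at u) v)"
      using Suc.IH Suc.prems(2) by (metis (no_types, lifting) Ck_on.simps(2))
  qed
qed

lemma Ck_on_subset: "Ck_on n S h \<Longrightarrow> T \<subseteq> S \<Longrightarrow> Ck_on n T h"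
  by (induction n arbitrary: h) (auto intro: continuous_on_subset)

lemma Ck_on_open_cover:
  assumes "\<And>u. u \<in> S \<Longrightarrow> \<exists>T. open T \<and> u \<in> T \<and> Ck_on n T h"
  shows "Ck_on n S h"
  using assms
proof (induction n arbitrary: h)
  case 0
  have "isCont h u" if "u \<in> S" for u
    using 0[OF that] by (auto simp: continuous_on_eq_continuous_at)
  then show ?case by (simp add: continuous_at_imp_continuous_on)
next
  case (Suc n)
  show ?case
    unfolding Ck_on.simps
  proof (intro conjI ballI allI)
    show "h differentiable (at u)" if "u \<in> S" for u using Suc.prems[OF that] by auto
    show "Ck_on n S (\<lambda>u. frechet_derivative h (at u) v)" for v
      by (rule Suc.IH) (use Suc.prems in fastforce)
  qed
qed

lemma Ck_on_lower: "open S \<Longrightarrow> Ck_on (Suc n) S h \<Longrightarrow> Ck_on n S h"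
proof (induction n arbitrary: h)
  case 0
  then show ?case
    by (auto intro!: continuous_at_imp_continuous_on differentiable_imp_continuous_within)
next
  case (Suc n)
  then show ?case by (metis Ck_on.simps(2))
qed

lemma Ck_on_const [simp]: "Ck_on n S (\<lambda>_. c)"
  by (induction n arbitrary: c) auto

lemma Ck_on_bounded_linear:
  assumes "open S" "bounded_linear L" "Ck_on n S h"
  shows "Ck_on n S (\<lambda>u. L (h u))"
  using assms(3)
proof (induction n arbitrary: h)
  case 0
  then show ?case using bounded_linear.continuous_on[OF assms(2)] by simp
next
  case (Suc n)
  have d: "((\<lambda>u. L (h u)) has_derivative (\<lambda>v. L (frechet_derivative h (at u) v))) (at u)"
    if "u \<in> S" for u
    using bounded_linear.has_derivative[OF assms(2) differentiable_has_derivative] Suc.prems that by auto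
  show ?case
    unfolding Ck_on.simps
  proof (intro conjI ballI allI)
    show "(\<lambda>u. L (h u)) differentiable (at u)" if "u \<in> S" for u
      using d[OF that] by (auto simp: differentiable_def)
    fix v
    show "Ck_on n S (\<lambda>u. frechet_derivative (\<lambda>u. L (h u)) (at u) v)"
      by (rule Ck_on_cong[OF assms(1) _ Suc.IH, of "\<lambda>u. frechet_derivative h (at u) v"])
        (use Suc.prems in \<open>simp_all add: frechet_derivative_eqI[OF d]\<close>)
  qed
qed

lemma Ck_on_ident: "Ck_on n S (\<lambda>u. u)"
  by (cases n) auto

lemma Ck_on_linear: "open S \<Longrightarrow> bounded_linear L \<Longrightarrow> Ck_on n S L"
  using Ck_on_bounded_linear[OF _ _ Ck_on_ident] .

lemma Ck_on_add:
  assumes "open S" "Ck_on n S h" "Ck_on n S k"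
  shows "Ck_on n S (\<lambda>u. h u + k u)"
  using assms(2,3)
proof (induction n arbitrary: h k)
  case 0
  then show ?case by (simp add: continuous_on_add)
next
  case (Suc n)
  have d: "((\<lambda>u. h u + k u) has_derivative
      (\<lambda>v. frechet_derivative h (at u) v + frechet_derivative k (at u) v)) (at u)" if "u \<in> S" for u
    using Suc.prems that by (intro has_derivative_add differentiable_has_derivative) auto
  show ?case
    unfolding Ck_on.simps
  proof (intro conjI ballI allI)
    show "(\<lambda>u. h u + k u) differentiable (at u)" if "u \<in> S" for u
      using d[OF that] by (auto simp: differentiable_def)
    fix v
    show "Ck_on n S (\<lambda>u. frechet_derivative (\<lambda>u. h u + k u) (at u) v)"
      by (rule Ck_on_cong[OF assms(1) _ Suc.IH,
            of "\<lambda>u. frechet_derivative h (at u) v" "\<lambda>u. frechet_derivative k (at u) v"])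
        (use Suc.prems in \<open>simp_all add: frechet_derivative_eqI[OF d]\<close>)
  qed
qed

lemma Ck_on_sum:
  assumes "open S" "finite I" "\<And>i. i \<in> I \<Longrightarrow> Ck_on n S (h i)"
  shows "Ck_on n S (\<lambda>u. \<Sum>i\<in>I. h i u)"
  using assms(2,3) by (induction I rule: finite_induct) (auto intro: Ck_on_add[OF assms(1)])

lemma Ck_on_bilinear:
  assumes "open S" "bounded_bilinear B" "Ck_on n S h" "Ck_on n S k"
  shows "Ck_on n S (\<lambda>u. B (h u) (k u))"
  using assms(3,4)
proof (induction n arbitrary: h k)
  case 0
  then show ?case using bounded_bilinear.continuous_on[OF assms(2)] by simp
next
  case (Suc n)
  have d: "((\<lambda>u. B (h u) (k u)) has_derivative
      (\<lambda>v. B (h u) (frechet_derivative k (at u) v) + B (frechet_derivative h (at u) v) (k u))) (at u)"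
    if "u \<in> S" for u
    using Suc.prems that
    by (intro bounded_bilinear.FDERIV[OF assms(2)] differentiable_has_derivative) auto
  have 1: "Ck_on n S (\<lambda>u. B (h u) (frechet_derivative k (at u) v)
      + B (frechet_derivative h (at u) v) (k u))" for v
    using Suc.prems Ck_on_lower[OF assms(1) Suc.prems(1)] Ck_on_lower[OF assms(1) Suc.prems(2)]
    by (intro Ck_on_add[OF assms(1)] Suc.IH) auto
  show ?case
    unfolding Ck_on.simps
  proof (intro conjI ballI allI)
    show "(\<lambda>u. B (h u) (k u)) differentiable (at u)" if "u \<in> S" for u
      using d[OF that] by (auto simp: differentiable_def)
    fix v
    show "Ck_on n S (\<lambda>u. frechet_derivative (\<lambda>u. B (h u) (k u)) (at u) v)"
      by (rule Ck_on_cong[OF assms(1) _ 1[of v]]) (simp add: frechet_derivative_eqI[OF d])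
  qed
qed

lemma Ck_on_compose:
  fixes \<phi> :: "'e::euclidean_space \<Rightarrow> 'g::euclidean_space"
  assumes "open S" "open T" "Ck_on n T h" "Ck_on n S \<phi>" "\<phi> ` S \<subseteq> T"
  shows "Ck_on n S (\<lambda>u. h (\<phi> u))"
  using assms(3,4)
proof (induction n arbitrary: h)
  case 0
  then show ?case using assms(5) continuous_on_compose2 by auto
next
  case (Suc n)
  have dp: "\<phi> differentiable (at u)" and dh: "h differentiable (at (\<phi> u))" if "u \<in> S" for u
    using Suc.prems that assms(5) by auto
  have d: "((\<lambda>u. h (\<phi> u)) has_derivative
      (\<lambda>v. frechet_derivative h (at (\<phi> u)) (frechet_derivative \<phi> (at u) v))) (at u)" if "u \<in> S" for u
    using diff_chain_at[OF differentiable_has_derivative[OF dp] differentiable_has_derivative[OF dh]] that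
    by (simp add: o_def)
  show ?case
    unfolding Ck_on.simps
  proof (intro conjI ballI allI)
    show "(\<lambda>u. h (\<phi> u)) differentiable (at u)" if "u \<in> S" for u
      using d[OF that] by (auto simp: differentiable_def)
    fix v
    show "Ck_on n S (\<lambda>u. frechet_derivative (\<lambda>u. h (\<phi> u)) (at u) v)"
    proof (rule Ck_on_cong[OF assms(1)])
      show "(\<Sum>b\<in>Basis. (frechet_derivative \<phi> (at u) v \<bullet> b) *\<^sub>R frechet_derivative h (at (\<phi> u)) b)
          = frechet_derivative (\<lambda>u. h (\<phi> u)) (at u) v" if "u \<in> S" for u
        by (simp add: frechet_derivative_eqI[OF d[OF that]]
            frechet_derivative_expand[OF dh[OF that], of "frechet_derivative \<phi> (at u) v"])
      show "Ck_on n S (\<lambda>u. \<Sum>b\<in>Basis.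
          (frechet_derivative \<phi> (at u) v \<bullet> b) *\<^sub>R frechet_derivative h (at (\<phi> u)) b)"
        using Suc.prems Ck_on_lower[OF assms(1) Suc.prems(2)]
        by (intro Ck_on_sum Ck_on_bilinear[OF _ bounded_bilinear_scaleR] Suc.IH
            Ck_on_bounded_linear[OF _ bounded_linear_inner_left] assms) auto
    qed
  qed
qed

lemma smooth_on_differentiable: "smooth_on S h \<Longrightarrow> u \<in> S \<Longrightarrow> h differentiable (at u)"
  unfolding smooth_on_def using Ck_on.simps(2) by blast

lemma smooth_on_derivative:
  "smooth_on S h \<Longrightarrow> smooth_on S (\<lambda>u. frechet_derivative h (at u) v)"
  unfolding smooth_on_def using Ck_on.simps(2) by blast

lemma smooth_on_imp_continuous_on: "smooth_on S h \<Longrightarrow> continuous_on S h"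
  unfolding smooth_on_def using Ck_on.simps(1) by blast

lemma smooth_on_inner: "open S \<Longrightarrow> smooth_on S h \<Longrightarrow> smooth_on S (\<lambda>u. h u \<bullet> b)"
  unfolding smooth_on_def using Ck_on_bounded_linear[OF _ bounded_linear_inner_left] by blast

text \<open>The left-hand side is symmetric in \<open>v\<close> and \<open>w\<close>, while the right-hand side differentiates first along
  \<open>v\<close> and then along \<open>w\<close>: the mean value theorem is used once in each direction.\<close>

lemma second_difference_mean_value:
  fixes h :: "'e::euclidean_space \<Rightarrow> real"
  assumes "smooth_on (ball u r) h" "t > 0" "t * (norm v + norm w) < r"
  shows "\<exists>x\<in>ball u r. h (u + t *\<^sub>R v + t *\<^sub>R w) - h (u + t *\<^sub>R v) - h (u + t *\<^sub>R w) + h u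
    = t * t * frechet_derivative (\<lambda>a. frechet_derivative h (at a) v) (at x) w"
proof -
  have inb: "u + s *\<^sub>R v + s' *\<^sub>R w \<in> ball u r" if "0 \<le> s" "s \<le> t" "0 \<le> s'" "s' \<le> t" for s s'
  proof -
    have "norm (s *\<^sub>R v + s' *\<^sub>R w) \<le> s * norm v + s' * norm w"
      using norm_triangle_ineq[of "s *\<^sub>R v" "s' *\<^sub>R w"] that by simp
    also have "\<dots> \<le> t * norm v + t * norm w"
      using that by (intro add_mono mult_right_mono) auto
    finally have "norm (s *\<^sub>R v + s' *\<^sub>R w) < r"
      using assms(3) by (simp add: distrib_left)
    then show ?thesis using norm_minus_cancel[of "s *\<^sub>R v + s' *\<^sub>R w"]
      by (simp add: dist_norm)
  qed
  have dh: "h differentiable (at a)" if "a \<in> ball u r" for a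
    using smooth_on_differentiable[OF assms(1) that] .
  have dd: "(\<lambda>a. frechet_derivative h (at a) v) differentiable (at a)" if "a \<in> ball u r" for a
    using smooth_on_differentiable[OF smooth_on_derivative[OF assms(1)] that] .
  have D1: "((\<lambda>s. h (u + s *\<^sub>R v + s' *\<^sub>R w)) has_derivative
      (\<lambda>k. k * frechet_derivative h (at (u + s *\<^sub>R v + s' *\<^sub>R w)) v)) (at s)"
    if "0 \<le> s" "s \<le> t" "0 \<le> s'" "s' \<le> t" for s s'
  proof -
    note H = differentiable_has_derivative[OF dh[OF inb[OF that]]]
    have "((\<lambda>s. u + s *\<^sub>R v + s' *\<^sub>R w) has_derivative (\<lambda>k. k *\<^sub>R v)) (at s)"
      by (auto intro!: derivative_eq_intros)
    from diff_chain_at[OF this H] show ?thesis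
      by (simp add: o_def linear_cmul[OF has_derivative_linear[OF H]])
  qed
  have D2: "((\<lambda>s'. frechet_derivative h (at (u + s *\<^sub>R v + s' *\<^sub>R w)) v) has_derivative
      (\<lambda>k. k * frechet_derivative (\<lambda>a. frechet_derivative h (at a) v)
         (at (u + s *\<^sub>R v + s' *\<^sub>R w)) w)) (at s')"
    if "0 \<le> s" "s \<le> t" "0 \<le> s'" "s' \<le> t" for s s'
  proof -
    note H = differentiable_has_derivative[OF dd[OF inb[OF that]]]
    have "((\<lambda>s'. u + s *\<^sub>R v + s' *\<^sub>R w) has_derivative (\<lambda>k. k *\<^sub>R w)) (at s')"
      by (auto intro!: derivative_eq_intros)
    from diff_chain_at[OF this H] show ?thesis
      by (simp add: o_def linear_cmul[OF has_derivative_linear[OF H]])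
  qed
  let ?d = "\<lambda>s s'. frechet_derivative h (at (u + s *\<^sub>R v + s' *\<^sub>R w)) v"
  have "\<exists>s. 0 < s \<and> s < t \<and> (h (u + t *\<^sub>R v + t *\<^sub>R w) - h (u + t *\<^sub>R v + 0 *\<^sub>R w))
      - (h (u + 0 *\<^sub>R v + t *\<^sub>R w) - h (u + 0 *\<^sub>R v + 0 *\<^sub>R w)) = (t - 0) * (?d s t - ?d s 0)"
    using assms(2) D1[of _ t] D1[of _ 0]
    by (intro MVT2[of 0 t "\<lambda>s. h (u + s *\<^sub>R v + t *\<^sub>R w) - h (u + s *\<^sub>R v + 0 *\<^sub>R w)"
          "\<lambda>s. ?d s t - ?d s 0"])
      (auto simp: has_field_derivative_def algebra_simps intro!: derivative_eq_intros)
  then obtain s where s: "0 < s" "s < t" and eq1: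
    "h (u + t *\<^sub>R v + t *\<^sub>R w) - h (u + t *\<^sub>R v) - h (u + t *\<^sub>R w) + h u = t * (?d s t - ?d s 0)"
    by (auto simp: algebra_simps)
  have "\<exists>s'. 0 < s' \<and> s' < t \<and> ?d s t - ?d s 0
      = (t - 0) * frechet_derivative (\<lambda>a. frechet_derivative h (at a) v) (at (u + s *\<^sub>R v + s' *\<^sub>R w)) w"
    using assms(2) D2[of s] s
    by (intro MVT2[of 0 t "?d s"]) (auto simp: has_field_derivative_def mult_commute_abs)
  then obtain s' where s': "0 < s'" "s' < t" and eq2: "?d s t - ?d s 0
      = t * frechet_derivative (\<lambda>a. frechet_derivative h (at a) v) (at (u + s *\<^sub>R v + s' *\<^sub>R w)) w"
    by auto
  show ?thesis
    using inb[of s s'] s s' eq1 eq2 by (intro bexI[of _ "u + s *\<^sub>R v + s' *\<^sub>R w"]) auto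
qed

text \<open>Schwarz: on arbitrarily small squares the two iterated derivatives take a common value, though
  perhaps at different points; continuity then identifies them at \<open>u\<close>.\<close>

lemma second_derivative_symmetric_real:
  fixes h :: "'e::euclidean_space \<Rightarrow> real"
  assumes "open S" "u \<in> S" "smooth_on S h"
  shows "frechet_derivative (\<lambda>a. frechet_derivative h (at a) v) (at u) w
       = frechet_derivative (\<lambda>a. frechet_derivative h (at a) w) (at u) v" (is "?A u = ?C u")
proof (rule ccontr)
  assume ne: "?A u \<noteq> ?C u"
  define e where "e = \<bar>?A u - ?C u\<bar> / 2"
  have e: "e > 0" using ne by (simp add: e_def)
  have near: "\<exists>r>0. \<forall>x\<in>S. dist x u < r \<longrightarrow>
      dist (frechet_derivative (\<lambda>a. frechet_derivative h (at a) y) (at x) z)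
           (frechet_derivative (\<lambda>a. frechet_derivative h (at a) y) (at u) z) < e" for y z
    using smooth_on_imp_continuous_on[OF smooth_on_derivative[OF smooth_on_derivative[OF assms(3)]]]
      assms(2) e unfolding continuous_on_iff by blast
  obtain r1 where r1: "r1 > 0" and A: "\<And>x. x \<in> S \<Longrightarrow> dist x u < r1 \<Longrightarrow> dist (?A x) (?A u) < e"
    using near[of v w] by blast
  obtain r2 where r2: "r2 > 0" and C: "\<And>x. x \<in> S \<Longrightarrow> dist x u < r2 \<Longrightarrow> dist (?C x) (?C u) < e"
    using near[of w v] by blast
  obtain r3 where r3: "r3 > 0" "ball u r3 \<subseteq> S" using assms(1,2) openE by blast
  define r where "r = min r3 (min r1 r2)"
  have r0: "r > 0" and sub: "ball u r \<subseteq> S" using r1 r2 r3 by (auto simp: r_def)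
  define t where "t = r / (2 * (norm v + norm w + 1))"
  have n: "norm v + norm w + 1 > 0" by (smt (verit) norm_ge_zero)
  then have t: "t > 0" "t * (norm v + norm w + 1) = r / 2" using r0 by (auto simp: t_def field_simps)
  then have tr: "t * (norm v + norm w) < r" "t * (norm w + norm v) < r"
    using r0 by (auto simp: algebra_simps)
  have sm: "smooth_on (ball u r) h" using assms(3) sub Ck_on_subset unfolding smooth_on_def by blast
  obtain x where x: "x \<in> ball u r" and
    "h (u + t *\<^sub>R v + t *\<^sub>R w) - h (u + t *\<^sub>R v) - h (u + t *\<^sub>R w) + h u = t * t * ?A x"
    using second_difference_mean_value[OF sm t(1) tr(1)] by blast
  moreover obtain y where y: "y \<in> ball u r" and
    "h (u + t *\<^sub>R w + t *\<^sub>R v) - h (u + t *\<^sub>R w) - h (u + t *\<^sub>R v) + h u = t * t * ?C y"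
    using second_difference_mean_value[OF sm t(1) tr(2)] by blast
  moreover have "u + t *\<^sub>R w + t *\<^sub>R v = u + t *\<^sub>R v + t *\<^sub>R w" by simp
  ultimately have "t * t * ?A x = t * t * ?C y" by (smt (verit, best))
  then have "?A x = ?C y" using t(1) by simp
  moreover have "dist (?A x) (?A u) < e" "dist (?C y) (?C u) < e"
    using A[of x] C[of y] x y sub by (auto simp: r_def dist_commute)
  ultimately have "\<bar>?A u - ?C u\<bar> < e + e" unfolding dist_real_def by linarith
  then show False by (simp add: e_def)
qed

lemma frechet_derivative_inner:
  "h differentiable (at u) \<Longrightarrow>
    frechet_derivative (\<lambda>a. h a \<bullet> b) (at u) v = frechet_derivative h (at u) v \<bullet> b"
  using frechet_derivative_eqI[OF has_derivative_inner_left[OF differentiable_has_derivative]] by metis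

lemma second_derivative_symmetric:
  fixes h :: "'e::euclidean_space \<Rightarrow> 'g::euclidean_space"
  assumes "open S" "u \<in> S" "smooth_on S h"
  shows "frechet_derivative (\<lambda>a. frechet_derivative h (at a) v) (at u) w
       = frechet_derivative (\<lambda>a. frechet_derivative h (at a) w) (at u) v"
proof (rule euclidean_eqI)
  fix b :: 'g
  have *: "frechet_derivative (\<lambda>a. frechet_derivative h (at a) v) (at u) w \<bullet> b
      = frechet_derivative (\<lambda>a. frechet_derivative (\<lambda>a. h a \<bullet> b) (at a) v) (at u) w" for v w
  proof -
    have d: "(\<lambda>a. frechet_derivative h (at a) v) differentiable (at u)"
      using smooth_on_differentiable[OF smooth_on_derivative[OF assms(3)] assms(2)] .
    have "(\<lambda>a. frechet_derivative h (at a) v \<bullet> b) differentiable (at u)"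
      using d by (auto simp: differentiable_def intro: has_derivative_inner_left)
    then have "frechet_derivative (\<lambda>a. frechet_derivative h (at a) v \<bullet> b) (at u)
        = frechet_derivative (\<lambda>a. frechet_derivative (\<lambda>a. h a \<bullet> b) (at a) v) (at u)"
      by (rule frechet_derivative_transform_within_open[OF _ assms(1,2)])
        (simp add: frechet_derivative_inner smooth_on_differentiable[OF assms(3)])
    then show ?thesis using frechet_derivative_inner[OF d] by metis
  qed
  show "frechet_derivative (\<lambda>a. frechet_derivative h (at a) v) (at u) w \<bullet> b
      = frechet_derivative (\<lambda>a. frechet_derivative h (at a) w) (at u) v \<bullet> b"
    unfolding * by (rule second_derivative_symmetric_real[OF assms(1,2) smooth_on_inner[OF assms(1,3)]])
qed

section \<open>Bump functions\<close>

text \<open>The extra factor \<open>t\<^sup>-\<^sup>k\<close> makes the family closed under differentiation up to linear combinations;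
  so once each member is differentiable, all of them are smooth.\<close>

definition flat_exp :: "nat \<Rightarrow> real \<Rightarrow> real" where
  "flat_exp k t = (if t > 0 then inverse t ^ k * exp (- inverse t) else 0)"

lemma flat_exp_tendsto_0: "(flat_exp k \<longlongrightarrow> 0) (at 0)"
proof (rule filterlim_split_at)
  have "eventually (\<lambda>t. flat_exp k t = 0) (at_left 0)"
    by (auto simp: flat_exp_def eventually_at_filter)
  then show "(flat_exp k \<longlongrightarrow> 0) (at_left 0)" by (simp add: tendsto_eventually)
  have "((\<lambda>t. (\<lambda>x. x ^ k / exp x) (inverse t)) \<longlongrightarrow> (0::real)) (at_right 0)"
    by (rule filterlim_compose[OF tendsto_power_div_exp_0 filterlim_inverse_at_top_right])
  moreover have "eventually (\<lambda>t. inverse t ^ k / exp (inverse t) = flat_exp k t) (at_right (0::real))"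
    by (auto simp: flat_exp_def eventually_at_filter exp_minus field_simps)
  ultimately show "(flat_exp k \<longlongrightarrow> 0) (at_right 0)"
    by (rule Lim_transform_eventually)
qed

lemma flat_exp_derivative:
  "(flat_exp k has_real_derivative flat_exp (k + 2) t - real k * flat_exp (k + 1) t) (at t)"
proof -
  consider "t > 0" | "t < 0" | "t = 0" by linarith
  then show ?thesis
  proof cases
    case 1
    have inv_pow: "((\<lambda>t. inverse t ^ k) has_real_derivative - real k * inverse t ^ (k + 1)) (at t)" for k
    proof (induction k)
      case (Suc k)
      then show ?case
        using DERIV_mult[OF DERIV_inverse Suc.IH] 1 by (simp add: algebra_simps)
    qed simp
    have "((\<lambda>t. inverse t ^ k * exp (- inverse t)) has_real_derivative
        flat_exp (k + 2) t - real k * flat_exp (k + 1) t) (at t)"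
      using DERIV_mult[OF inv_pow[of k] DERIV_chain'[OF DERIV_minus[OF DERIV_inverse] DERIV_exp, of t]] 1
      by (simp add: flat_exp_def algebra_simps)
    then show ?thesis
      by (rule has_field_derivative_transform_within_open[where S = "{0<..}"])
        (use 1 in \<open>auto simp: flat_exp_def\<close>)
  next
    case 2
    have "((\<lambda>_. 0) has_real_derivative flat_exp (k + 2) t - real k * flat_exp (k + 1) t) (at t)"
      using 2 by (simp add: flat_exp_def)
    then show ?thesis
      by (rule has_field_derivative_transform_within_open[where S = "{..<0}"])
        (use 2 in \<open>auto simp: flat_exp_def\<close>)
  next
    case 3
    have "(\<lambda>x. (flat_exp k x - flat_exp k 0) / (x - 0)) = flat_exp (k + 1)"
      by (auto simp: fun_eq_iff flat_exp_def field_simps)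
    then show ?thesis
      using flat_exp_tendsto_0[of "k + 1"] by (simp add: 3 has_field_derivative_iff flat_exp_def)
  qed
qed

lemma Ck_on_flat_exp: "Ck_on n UNIV (flat_exp k)"
proof (induction n arbitrary: k)
  case 0
  then show ?case
    using flat_exp_derivative by (auto intro!: continuous_at_imp_continuous_on DERIV_isCont)
next
  case (Suc n)
  have d: "(flat_exp k has_derivative (\<lambda>v. (flat_exp (k + 2) t + (- real k) * flat_exp (k + 1) t) * v)) (at t)"
    for t using flat_exp_derivative[of k t] by (simp add: has_field_derivative_def)
  show ?case
    unfolding Ck_on.simps frechet_derivative_eqI[OF d]
  proof (intro conjI ballI allI)
    show "flat_exp k differentiable (at t)" for t using d by (auto simp: differentiable_def)
    show "Ck_on n UNIV (\<lambda>t. (flat_exp (k + 2) t + (- real k) * flat_exp (k + 1) t) * v)" for v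
      by (rule Ck_on_bounded_linear[OF open_UNIV bounded_linear_mult_left]
          Ck_on_add[OF open_UNIV] Ck_on_bounded_linear[OF open_UNIV bounded_linear_mult_right] Suc.IH)+
  qed
qed

lemma bump_function_exists:
  fixes u\<^sub>0 :: "'e::euclidean_space"
  assumes "r > 0"
  obtains b :: "'e \<Rightarrow> real"
  where "smooth_on UNIV b" "b u\<^sub>0 = 1" "\<And>u. u \<notin> cball u\<^sub>0 r \<Longrightarrow> b u = 0"
proof
  let ?q = "\<lambda>u. r\<^sup>2 - (u - u\<^sub>0) \<bullet> (u - u\<^sub>0)"
  let ?b = "\<lambda>u. flat_exp 0 (?q u) * inverse (flat_exp 0 (r\<^sup>2))"
  have sub: "Ck_on n UNIV (\<lambda>u. u + (- u\<^sub>0))" for n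
    by (rule Ck_on_add[OF open_UNIV Ck_on_ident Ck_on_const])
  have "Ck_on n UNIV (\<lambda>u. r\<^sup>2 + (-1) * ((u + (- u\<^sub>0)) \<bullet> (u + (- u\<^sub>0))))" for n
    by (rule Ck_on_add[OF open_UNIV] Ck_on_const Ck_on_bounded_linear[OF open_UNIV bounded_linear_mult_right]
        Ck_on_bilinear[OF open_UNIV bounded_bilinear_inner] sub)+
  then have "Ck_on n UNIV ?q" for n by simp
  then have "Ck_on n UNIV (\<lambda>u. flat_exp 0 (?q u))" for n
    by (rule Ck_on_compose[OF open_UNIV open_UNIV Ck_on_flat_exp]) simp
  then show "smooth_on UNIV ?b"
    unfolding smooth_on_def using Ck_on_bounded_linear[OF open_UNIV bounded_linear_mult_left] by blast
  show "?b u\<^sub>0 = 1" using assms by (simp add: flat_exp_def)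
  show "?b u = 0" if "u \<notin> cball u\<^sub>0 r" for u
  proof -
    have "r \<le> norm (u - u\<^sub>0)" using that by (simp add: dist_norm norm_minus_commute)
    then have "r\<^sup>2 \<le> (u - u\<^sub>0) \<bullet> (u - u\<^sub>0)"
      using assms by (metis dot_square_norm less_imp_le power_mono)
    then show ?thesis by (simp add: flat_exp_def)
  qed
qed

section \<open>Charts and changes of coordinates\<close>

text \<open>Jacobian of a transition map, indexed by the point of the manifold.  Both \<^const>\<open>to_chart\<close> and
  \<^const>\<open>from_chart\<close> are instances in which one chart is the preferred one, so that all changes of
  coordinates reduce to a single chain rule.\<close>

definition coord_change :: "('a, 'e::euclidean_space) chart \<Rightarrow> ('a, 'e) chart \<Rightarrow> 'a \<Rightarrow> 'e \<Rightarrow> 'e" where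
  "coord_change c d x = frechet_derivative (cmap d \<circ> cinv c) (at (cmap c x))"

lemma to_chart_eq: "to_chart M c x = coord_change (chart_at M x) c x"
  by (simp add: to_chart_def coord_change_def)

lemma from_chart_eq: "from_chart M c x = coord_change c (chart_at M x) x"
  by (simp add: from_chart_def coord_change_def)

lemma chart_homeomorphism: "is_chart c \<Longrightarrow> homeomorphism (cdom c) (cimg c) (cmap c) (cinv c)"
  by (simp add: is_chart_def)

lemma chart_inv [simp]: "is_chart c \<Longrightarrow> x \<in> cdom c \<Longrightarrow> cinv c (cmap c x) = x"
  using homeomorphism_apply1[OF chart_homeomorphism] .

lemma chart_map_inv [simp]: "is_chart c \<Longrightarrow> u \<in> cimg c \<Longrightarrow> cmap c (cinv c u) = u"
  using homeomorphism_apply2[OF chart_homeomorphism] .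

lemma cinv_in_cdom [simp]: "is_chart c \<Longrightarrow> u \<in> cimg c \<Longrightarrow> cinv c u \<in> cdom c"
  using homeomorphism_image2[OF chart_homeomorphism] by blast

lemma continuous_on_cinv: "is_chart c \<Longrightarrow> continuous_on (cimg c) (cinv c)"
  using homeomorphism_cont2[OF chart_homeomorphism] .

lemma cmap_in_cimg [simp]: "x \<in> cdom c \<Longrightarrow> cmap c x \<in> cimg c"
  by (simp add: cimg_def)

lemma open_cimg: "is_chart c \<Longrightarrow> open (cimg c)"
  by (simp add: is_chart_def)

lemma open_cdom: "is_chart c \<Longrightarrow> open (cdom c)"
  by (simp add: is_chart_def)

lemma chart_image_eq:
  assumes "is_chart c" "A \<subseteq> cdom c"
  shows "cmap c ` A = {u \<in> cimg c. cinv c u \<in> A}"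
proof (intro set_eqI iffI)
  fix u assume "u \<in> cmap c ` A"
  then obtain x where "x \<in> A" "u = cmap c x" by blast
  then show "u \<in> {u \<in> cimg c. cinv c u \<in> A}" using assms by auto
next
  fix u assume "u \<in> {u \<in> cimg c. cinv c u \<in> A}"
  then show "u \<in> cmap c ` A" using chart_map_inv[OF assms(1), of u] by (metis (mono_tags) image_eqI mem_Collect_eq)
qed

lemma open_chart_image:
  assumes "is_chart c" "open A"
  shows "open (cmap c ` (cdom c \<inter> A))"
proof -
  have "open (cimg c \<inter> cinv c -` A)"
    using assms by (intro continuous_open_preimage continuous_on_cinv open_cimg)
  moreover have "cmap c ` (cdom c \<inter> A) = cimg c \<inter> cinv c -` A"
    unfolding chart_image_eq[OF assms(1) Int_lower1] using assms(1) by auto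
  ultimately show ?thesis by simp
qed

context
  fixes M :: "('a::{t2_space, second_countable_topology}, 'e::euclidean_space) manifold"
  assumes M: "smooth_manifold M"
begin

lemma atlas_is_chart: "c \<in> atlas M \<Longrightarrow> is_chart c"
  using M by (simp add: smooth_manifold_def)

lemma chart_at_atlas: "x \<in> points M \<Longrightarrow> chart_at M x \<in> atlas M"
  using M by (simp add: smooth_manifold_def)

lemma in_chart_at: "x \<in> points M \<Longrightarrow> x \<in> cdom (chart_at M x)"
  using M by (simp add: smooth_manifold_def)

lemma cdom_points: "c \<in> atlas M \<Longrightarrow> x \<in> cdom c \<Longrightarrow> x \<in> points M"
  by (auto simp: points_def)

lemma smooth_transition:
  "c \<in> atlas M \<Longrightarrow> d \<in> atlas M \<Longrightarrow> smooth_on (cmap c ` (cdom c \<inter> cdom d)) (cmap d \<circ> cinv c)"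
  using M by (simp add: smooth_manifold_def)

lemma open_overlap:
  "c \<in> atlas M \<Longrightarrow> d \<in> atlas M \<Longrightarrow> open (cmap c ` (cdom c \<inter> cdom d))"
  by (intro open_chart_image atlas_is_chart open_cdom)

lemma has_derivative_transition:
  assumes "c \<in> atlas M" "d \<in> atlas M" "x \<in> cdom c" "x \<in> cdom d"
  shows "((cmap d \<circ> cinv c) has_derivative coord_change c d x) (at (cmap c x))"
  unfolding coord_change_def
  by (rule differentiable_has_derivative[OF smooth_on_differentiable[OF smooth_transition]])
    (use assms in auto)

lemma linear_coord_change:
  assumes "c \<in> atlas M" "d \<in> atlas M" "x \<in> cdom c" "x \<in> cdom d"
  shows "linear (coord_change c d x)"
  using has_derivative_linear[OF has_derivative_transition[OF assms]] .

lemma coord_change_compose: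
  assumes "c \<in> atlas M" "d \<in> atlas M" "e \<in> atlas M" "x \<in> cdom c" "x \<in> cdom d" "x \<in> cdom e"
  shows "coord_change d e x (coord_change c d x v) = coord_change c e x v"
proof -
  have eq: "(cmap d \<circ> cinv c) (cmap c x) = cmap d x"
    using assms atlas_is_chart by simp
  have "((cmap e \<circ> cinv d) \<circ> (cmap d \<circ> cinv c) has_derivative coord_change d e x \<circ> coord_change c d x)
      (at (cmap c x))"
    using has_derivative_transition[OF assms(2,3,5,6)]
    by (intro diff_chain_at has_derivative_transition[OF assms(1,2,4,5)]) (simp only: eq)
  then have "((cmap e \<circ> cinv c) has_derivative coord_change d e x \<circ> coord_change c d x) (at (cmap c x))"
    by (rule has_derivative_transform_within_open[OF _ open_overlap[OF assms(1,2)]])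
      (use assms atlas_is_chart in \<open>auto\<close>)
  from has_derivative_unique[OF has_derivative_transition[OF assms(1,3,4,6)] this]
  show ?thesis by simp
qed

lemma coord_change_self:
  assumes "c \<in> atlas M" "x \<in> cdom c"
  shows "coord_change c c x v = v"
proof -
  have "((\<lambda>u. u) has_derivative (\<lambda>v. v)) (at (cmap c x))" by simp
  then have "((cmap c \<circ> cinv c) has_derivative (\<lambda>v. v)) (at (cmap c x))"
    by (rule has_derivative_transform_within_open[OF _ open_cimg[OF atlas_is_chart[OF assms(1)]]])
      (use assms atlas_is_chart in auto)
  from has_derivative_unique[OF has_derivative_transition[OF assms(1,1,2,2)] this]
  show ?thesis by simp
qed

lemma coord_change_inverse:
  assumes "c \<in> atlas M" "d \<in> atlas M" "x \<in> cdom c" "x \<in> cdom d"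
  shows "coord_change d c x (coord_change c d x v) = v"
  using coord_change_compose[OF assms(1,2,1,3,4,3)] coord_change_self[OF assms(1,3)] by simp

text \<open>Spread the constant-coefficient field of a chart by a bump function supported in that chart.
  The support is compact, hence closed because the manifold is Hausdorff; so in any other chart
  the field is smooth near the support and zero away from it.\<close>

lemma smooth_vector_field_through:
  assumes x: "x \<in> points M"
  obtains X where "smooth_vector_field M X" "X x = v"
proof -
  define c where "c = chart_at M x"
  have c: "c \<in> atlas M" "x \<in> cdom c" using x by (simp_all add: c_def chart_at_atlas in_chart_at)
  note ch = atlas_is_chart[OF c(1)]
  obtain r where r: "r > 0" "cball (cmap c x) r \<subseteq> cimg c"
    using open_contains_cball open_cimg[OF ch] cmap_in_cimg[OF c(2)] by blast
  obtain b :: "'e \<Rightarrow> real" where b: "smooth_on UNIV b" "b (cmap c x) = 1"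
    "\<And>u. u \<notin> cball (cmap c x) r \<Longrightarrow> b u = 0"
    using bump_function_exists[OF r(1), of "cmap c x"] by blast
  define K where "K = cinv c ` cball (cmap c x) r"
  have Kc: "K \<subseteq> cdom c" using r(2) ch by (auto simp: K_def)
  have "compact K"
    unfolding K_def
    by (intro compact_continuous_image continuous_on_subset[OF continuous_on_cinv[OF ch] r(2)] compact_cball)
  then have clK: "closed K" by (rule compact_imp_closed)
  define X where "X = (\<lambda>y. if y \<in> cdom c then b (cmap c y) *\<^sub>R from_chart M c y v else 0)"
  have X0: "X y = 0" if "y \<notin> K" for y
    using that b(3)[of "cmap c y"] ch by (force simp: X_def K_def image_iff)
  have "X x = v"
    using c b(2) by (simp add: X_def from_chart_eq c_def[symmetric] coord_change_self)
  moreover have "smooth_vector_field M X"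
    unfolding smooth_vector_field_def
  proof
    fix d assume d: "d \<in> atlas M"
    note chd = atlas_is_chart[OF d]
    let ?U = "cmap d ` (cdom d \<inter> cdom c)" and ?V = "cmap d ` (cdom d \<inter> (- K))"
    have oU: "open ?U" and oV: "open ?V"
      using open_overlap[OF d c(1)] open_chart_image[OF chd] clK by auto
    have lin: "linear (to_chart M d y)" if "y \<in> cdom d" for y
      using that d cdom_points[OF d that]
      by (auto simp: to_chart_eq intro!: linear_coord_change chart_at_atlas in_chart_at)
    have "Ck_on n ?U (vf_in M d X)" for n
    proof (rule Ck_on_cong[OF oU])
      let ?\<tau> = "cmap c \<circ> cinv d"
      let ?h = "\<lambda>u. b (?\<tau> u) *\<^sub>R frechet_derivative (cmap d \<circ> cinv c) (at (?\<tau> u)) v"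
      show "?h u = vf_in M d X u" if uU: "u \<in> ?U" for u
      proof -
        obtain y where y: "y \<in> cdom d" "y \<in> cdom c" "u = cmap d y" using uU by blast
        have py: "y \<in> points M" using cdom_points[OF d y(1)] .
        have "vf_in M d X u = b (cmap c y) *\<^sub>R to_chart M d y (from_chart M c y v)"
          using y chd linear_cmul[OF lin[OF y(1)]] by (simp add: vf_in_def X_def)
        also have "to_chart M d y (from_chart M c y v) = coord_change c d y v"
          unfolding to_chart_eq from_chart_eq using d c(1) y py
          by (intro coord_change_compose) (auto intro: chart_at_atlas in_chart_at)
        finally show ?thesis using y chd by (simp add: coord_change_def)
      qed
      have \<tau>: "Ck_on n ?U ?\<tau>" using smooth_transition[OF d c(1)] by (simp add: smooth_on_def)
      have im: "?\<tau> ` ?U \<subseteq> cmap c ` (cdom c \<inter> cdom d)" using chd by auto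
      have "Ck_on n ?U (\<lambda>u. b (?\<tau> u))"
        by (rule Ck_on_compose[OF oU open_UNIV _ \<tau>]) (use b(1) in \<open>auto simp: smooth_on_def\<close>)
      moreover have "Ck_on n (cmap c ` (cdom c \<inter> cdom d))
          (\<lambda>u. frechet_derivative (cmap d \<circ> cinv c) (at u) v)"
        using smooth_on_derivative[OF smooth_transition[OF c(1) d]] unfolding smooth_on_def by blast
      then have "Ck_on n ?U (\<lambda>u. frechet_derivative (cmap d \<circ> cinv c) (at (?\<tau> u)) v)"
        by (rule Ck_on_compose[OF oU open_overlap[OF c(1) d] _ \<tau> im])
      ultimately show "Ck_on n ?U ?h" by (rule Ck_on_bilinear[OF oU bounded_bilinear_scaleR])
    qed
    moreover have "Ck_on n ?V (vf_in M d X)" for n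
    proof (rule Ck_on_cong[OF oV _ Ck_on_const[of n _ 0]])
      fix u assume "u \<in> ?V"
      then obtain y where y: "y \<in> cdom d" "y \<notin> K" "u = cmap d y" by auto
      then show "0 = vf_in M d X u"
        using X0 chd linear_0[OF lin[OF y(1)]] by (simp add: vf_in_def)
    qed
    moreover have "u \<in> ?U \<or> u \<in> ?V" if "u \<in> cimg d" for u
      using that Kc by (auto simp: cimg_def)
    ultimately show "smooth_on (cimg d) (vf_in M d X)"
      unfolding smooth_on_def using oU oV by (intro allI Ck_on_open_cover) blast
  qed
  ultimately show thesis using that by blast
qed

end

section \<open>The Levi-Civita connection of a metric in one chart\<close>

text \<open>Product rule for a linear map that depends on the base point.  Differentiability for each fixed
  argument is enough, because the dimension is finite.\<close>

lemma has_derivative_linear_family: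
  fixes q :: "'e::euclidean_space \<Rightarrow> 'x::euclidean_space \<Rightarrow> 'y::real_normed_vector"
  assumes "open S" "u \<in> S" and lin: "\<And>a. a \<in> S \<Longrightarrow> linear (q a)"
    and q: "\<And>x. (\<lambda>a. q a x) differentiable (at u)" and \<alpha>: "\<alpha> differentiable (at u)"
  shows "((\<lambda>a. q a (\<alpha> a)) has_derivative
    (\<lambda>v. frechet_derivative (\<lambda>a. q a (\<alpha> u)) (at u) v + q u (frechet_derivative \<alpha> (at u) v))) (at u)"
proof -
  have exp: "q a x = (\<Sum>b\<in>Basis. (x \<bullet> b) *\<^sub>R q a b)" if "a \<in> S" for a x
  proof -
    interpret L: linear "q a" by (rule lin[OF that])
    show ?thesis by (subst euclidean_representation[of x, symmetric]) (simp only: L.sum L.scaleR)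
  qed
  have fixed: "frechet_derivative (\<lambda>a. q a x) (at u) v
      = (\<Sum>b\<in>Basis. (x \<bullet> b) *\<^sub>R frechet_derivative (\<lambda>a. q a b) (at u) v)" for x v
  proof -
    have "((\<lambda>a. \<Sum>b\<in>Basis. (x \<bullet> b) *\<^sub>R q a b) has_derivative
        (\<lambda>v. \<Sum>b\<in>Basis. (x \<bullet> b) *\<^sub>R frechet_derivative (\<lambda>a. q a b) (at u) v)) (at u)"
      by (intro has_derivative_sum has_derivative_scaleR_right differentiable_has_derivative q)
    then have "((\<lambda>a. q a x) has_derivative
        (\<lambda>v. \<Sum>b\<in>Basis. (x \<bullet> b) *\<^sub>R frechet_derivative (\<lambda>a. q a b) (at u) v)) (at u)"
      by (rule has_derivative_transform_within_open[OF _ assms(1,2)]) (simp flip: exp)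
    then show ?thesis by (simp add: frechet_derivative_eqI)
  qed
  have "((\<lambda>a. \<Sum>b\<in>Basis. (\<alpha> a \<bullet> b) *\<^sub>R q a b) has_derivative
      (\<lambda>v. \<Sum>b\<in>Basis. (\<alpha> u \<bullet> b) *\<^sub>R frechet_derivative (\<lambda>a. q a b) (at u) v
        + (frechet_derivative \<alpha> (at u) v \<bullet> b) *\<^sub>R q u b)) (at u)"
    by (intro has_derivative_sum has_derivative_scaleR has_derivative_inner_left
        differentiable_has_derivative q \<alpha>)
  then have "((\<lambda>a. \<Sum>b\<in>Basis. (\<alpha> a \<bullet> b) *\<^sub>R q a b) has_derivative
      (\<lambda>v. frechet_derivative (\<lambda>a. q a (\<alpha> u)) (at u) v + q u (frechet_derivative \<alpha> (at u) v))) (at u)"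
    by (simp add: sum.distrib fixed[of "\<alpha> u"] exp[OF assms(2), of "frechet_derivative \<alpha> (at u) _"])
  then show ?thesis
    by (rule has_derivative_transform_within_open[OF _ assms(1,2)]) (simp flip: exp)
qed

locale local_metric =
  fixes S :: "'e::euclidean_space set" and G :: "'e \<Rightarrow> 'e \<Rightarrow> 'e \<Rightarrow> real"
  assumes open_S: "open S"
    and bilin: "u \<in> S \<Longrightarrow> bilinear (G u)"
    and sym: "u \<in> S \<Longrightarrow> G u v w = G u w v"
    and pos: "u \<in> S \<Longrightarrow> v \<noteq> 0 \<Longrightarrow> G u v v > 0"
    and smooth: "smooth_on S (\<lambda>u. G u v w)"
begin

abbreviation dG :: "'e \<Rightarrow> 'e \<Rightarrow> 'e \<Rightarrow> 'e \<Rightarrow> real" where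
  "dG u v w \<equiv> frechet_derivative (\<lambda>a. G a v w) (at u)"

lemma lin_left: "u \<in> S \<Longrightarrow> linear (\<lambda>v. G u v w)"
  and lin_right: "u \<in> S \<Longrightarrow> linear (\<lambda>w. G u v w)"
  using bilin by (auto simp: bilinear_def)

lemmas G_linear_simps =
  linear_add[OF lin_left] linear_add[OF lin_right] linear_diff[OF lin_left] linear_diff[OF lin_right]
  linear_cmul[OF lin_left] linear_cmul[OF lin_right] linear_neg[OF lin_left] linear_neg[OF lin_right]

lemma has_derivative_G: "u \<in> S \<Longrightarrow> ((\<lambda>a. G a v w) has_derivative dG u v w) (at u)"
  by (intro differentiable_has_derivative smooth_on_differentiable[OF smooth])

lemma dG_eqI:
  assumes "u \<in> S" "(k has_derivative k') (at u)" "\<And>a. a \<in> S \<Longrightarrow> k a = G a v w"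
  shows "dG u v w = k'"
  using assms has_derivative_transform_within_open[OF assms(2) open_S assms(1), of "\<lambda>a. G a v w"]
  by (simp add: frechet_derivative_eqI)

lemma dG_linear: "u \<in> S \<Longrightarrow> linear (dG u v w)"
  using has_derivative_linear[OF has_derivative_G] .

lemma dG_sym: "u \<in> S \<Longrightarrow> dG u v w = dG u w v"
  by (rule dG_eqI[OF _ has_derivative_G]) (simp_all add: sym)

lemma dG_linear_left: "u \<in> S \<Longrightarrow> linear (\<lambda>v. dG u v w x)"
proof (rule linearI)
  assume u: "u \<in> S"
  show "dG u (v + v') w x = dG u v w x + dG u v' w x" for v v'
    by (subst dG_eqI[OF u has_derivative_add[OF has_derivative_G[OF u] has_derivative_G[OF u]]])
      (simp_all add: G_linear_simps)
  show "dG u (r *\<^sub>R v) w x = r *\<^sub>R dG u v w x" for r v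
    by (subst dG_eqI[OF u has_derivative_scaleR_right[OF has_derivative_G[OF u]]])
      (simp_all add: G_linear_simps)
qed

lemma dG_linear_right: "u \<in> S \<Longrightarrow> linear (\<lambda>w. dG u v w x)"
  using dG_linear_left[of u v x] by (simp add: dG_sym[of u v])

lemmas dG_linear_simps =
  linear_add[OF dG_linear] linear_add[OF dG_linear_left] linear_add[OF dG_linear_right]
  linear_cmul[OF dG_linear] linear_cmul[OF dG_linear_left] linear_cmul[OF dG_linear_right]

lemma nondegenerate:
  assumes "u \<in> S" "\<And>y. G u z y = G u z' y"
  shows "z = z'"
proof (rule ccontr)
  assume "z \<noteq> z'"
  then have "G u (z - z') (z - z') > 0" using pos[OF assms(1)] by simp
  then show False using assms by (simp add: G_linear_simps)
qed

text \<open>Lowering an index, with covectors written in the standard basis.\<close>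

lemma musical_map:
  assumes u: "u \<in> S"
  shows "linear (\<lambda>z. \<Sum>b\<in>Basis. G u z b *\<^sub>R b)" "inj (\<lambda>z. \<Sum>b\<in>Basis. G u z b *\<^sub>R b)"
proof -
  show lin: "linear (\<lambda>z. \<Sum>b\<in>Basis. G u z b *\<^sub>R b)"
    by (intro linearI) (simp_all add: G_linear_simps u sum.distrib scaleR_add_left scaleR_sum_right)
  show "inj (\<lambda>z. \<Sum>b\<in>Basis. G u z b *\<^sub>R b)"
    unfolding linear_injective_0[OF lin]
  proof (intro allI impI)
    fix z assume "(\<Sum>b\<in>Basis. G u z b *\<^sub>R b) = 0"
    then have "G u z b = 0" if "b \<in> Basis" for b
      using that by (metis inner_sum_left_Basis inner_zero_left)
    then have "G u z = (\<lambda>_. 0)"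
      by (intro linear_eq_stdbasis[OF lin_right[OF u] linear_zero])
    then have "G u z z = 0" by metis
    then show "z = 0" using pos[OF u, of z] by auto
  qed
qed

lemma riesz:
  assumes u: "u \<in> S" and K: "linear K"
  shows "\<exists>z. \<forall>y. G u z y = K y"
proof -
  obtain z where z: "(\<Sum>b\<in>Basis. G u z b *\<^sub>R b) = (\<Sum>b\<in>Basis. K b *\<^sub>R b)"
    using surjD[OF linear_injective_imp_surjective[OF musical_map[OF u]], of "\<Sum>b\<in>Basis. K b *\<^sub>R b"]
    by auto
  have "G u z b = K b" if "b \<in> Basis" for b
    using that arg_cong[OF z, of "\<lambda>z. z \<bullet> b"] by simp
  then have "G u z = K" by (intro linear_eq_stdbasis[OF lin_right[OF u] K])
  then show ?thesis by auto
qed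

text \<open>The solution is read off from the inverse of \<open>(u, z) \<mapsto> (u, G u z)\<close>, whose derivative is injective because
  \<open>G u\<close> is nondegenerate; so the inverse function theorem applies.  With the Koszul form as right-hand
  side this makes the Christoffel symbols differentiable, as the curvature requires.\<close>

lemma solution_differentiable:
  assumes u: "u \<in> S" and Z: "\<And>a y. a \<in> S \<Longrightarrow> G a (Z a) y = k a y"
    and k: "\<And>y. (\<lambda>a. k a y) differentiable (at u)"
  shows "Z differentiable (at u)"
proof -
  define \<Phi> where "\<Phi> = (\<lambda>p. (fst p, \<Sum>b\<in>Basis. (\<Sum>c\<in>Basis. (snd p \<bullet> c) * G (fst p) c b) *\<^sub>R b))"
  define \<Phi>' where "\<Phi>' = (\<lambda>(p::'e \<times> 'e) q. (fst q, \<Sum>b\<in>Basis.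
    (\<Sum>c\<in>Basis. (snd p \<bullet> c) * dG (fst p) c b (fst q) + (snd q \<bullet> c) * G (fst p) c b) *\<^sub>R b))"
  define \<Psi> where "\<Psi> = (\<lambda>p. (fst p, inv (\<lambda>z. \<Sum>b\<in>Basis. G (fst p) z b *\<^sub>R b) (snd p)))"
  define \<kappa> where "\<kappa> = (\<lambda>a. \<Sum>b\<in>Basis. k a b *\<^sub>R b)"
  have expand: "(\<Sum>c\<in>Basis. (z \<bullet> c) * G a c b) = G a z b" if "a \<in> S" for a z b
  proof -
    interpret L: linear "\<lambda>v. G a v b" by (rule lin_left[OF that])
    show ?thesis
      using L.sum[of "\<lambda>c. (z \<bullet> c) *\<^sub>R c" Basis] by (simp add: L.scaleR euclidean_representation)
  qed
  have der: "(\<Phi> has_derivative \<Phi>' p) (at p)" if "fst p \<in> S" for p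
  proof -
    have "((\<lambda>p. G (fst p) c b) has_derivative (\<lambda>q. dG (fst p) c b (fst q))) (at p)" for c b
      using diff_chain_at[OF has_derivative_fst[OF has_derivative_ident] has_derivative_G[OF that, of c b]]
      by (simp add: o_def)
    then show ?thesis
      unfolding \<Phi>_def \<Phi>'_def
      by (intro has_derivative_Pair has_derivative_sum has_derivative_scaleR_left has_derivative_mult
          has_derivative_fst has_derivative_snd has_derivative_inner_left has_derivative_ident)
  qed
  have inv: "\<Psi> (\<Phi> p) = p" if "fst p \<in> S" for p
    using inv_f_f[OF musical_map(2)[OF that]] that by (simp add: \<Phi>_def \<Psi>_def expand)
  have \<Phi>Z: "\<Phi> (a, Z a) = (a, \<kappa> a)" if "a \<in> S" for a
    using that by (simp add: \<Phi>_def \<kappa>_def expand Z)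
  have lin: "linear (\<Phi>' (u, Z u))" using has_derivative_linear[OF der] u by simp
  have "inj (\<Phi>' (u, Z u))"
    unfolding linear_injective_0[OF lin]
  proof (intro allI impI)
    fix q assume q: "\<Phi>' (u, Z u) q = 0"
    then have f: "fst q = 0" by (simp add: \<Phi>'_def zero_prod_def)
    have "(\<Sum>b\<in>Basis. G u (snd q) b *\<^sub>R b) = 0"
      using q f linear_0[OF dG_linear[OF u]] by (simp add: \<Phi>'_def zero_prod_def expand[OF u])
    then have "snd q = 0" using musical_map[OF u] linear_injective_0 by blast
    with f show "q = 0" by (simp add: prod_eq_iff)
  qed
  then obtain \<Psi>' where \<Psi>': "\<Phi>' (u, Z u) \<circ> \<Psi>' = id"
    using linear_injective_isomorphism[OF lin] by (auto simp: fun_eq_iff)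
  have "(\<Psi> has_derivative \<Psi>') (at (\<Phi> (u, Z u)))"
  proof (rule has_derivative_inverse_strong[where S = "S \<times> UNIV" and f = \<Phi> and x = "(u, Z u)" and f' = "\<Phi>' (u, Z u)"])
    show "open (S \<times> (UNIV :: 'e set))" using open_S by (simp add: open_Times)
    show "continuous_on (S \<times> UNIV) \<Phi>"
      by (intro continuous_at_imp_continuous_on ballI has_derivative_continuous[OF der]) auto
    show "(\<Phi> has_derivative \<Phi>' (u, Z u)) (at (u, Z u))" using der u by simp
  qed (use u inv \<Psi>' in auto)
  then have \<Psi>d: "\<Psi> differentiable (at (u, \<kappa> u))" using \<Phi>Z[OF u] by (auto simp: differentiable_def)
  have "\<kappa> differentiable (at u)"
    unfolding \<kappa>_def using k by (intro differentiable_sum differentiable_scaleR) auto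
  then have "(\<lambda>a. (a, \<kappa> a)) differentiable (at u)"
    by (rule differentiableI[OF has_derivative_Pair[OF has_derivative_ident differentiable_has_derivative]])
  then have "(\<Psi> \<circ> (\<lambda>a. (a, \<kappa> a))) differentiable (at u)"
    using \<Psi>d by (intro differentiable_chain_at) auto
  then have d: "(\<lambda>a. snd (\<Psi> (a, \<kappa> a))) differentiable (at u)"
    unfolding differentiable_def by (auto simp: o_def dest: has_derivative_snd)
  have "snd (\<Psi> (a, \<kappa> a)) = Z a" if "a \<in> S" for a
    using inv[of "(a, Z a)"] \<Phi>Z[OF that] that by simp
  then show ?thesis by (rule differentiable_transform_open[OF open_S u _ d])
qed

lemma koszul:
  assumes u: "u \<in> S"
  shows "2 * G u (loc_christoffel G u v w) y = dG u w y v + dG u v y w - dG u v w y"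
proof -
  let ?K = "\<lambda>y. (dG u w y v + dG u v y w - dG u v w y) / 2"
  have "linear ?K"
    by (intro linearI) (simp_all add: dG_linear_simps u field_simps)
  then obtain z where z: "\<forall>y. G u z y = ?K y" using riesz[OF u, of ?K] by blast
  have z2: "\<forall>y. 2 * G u z y = dG u w y v + dG u v y w - dG u v w y"
    unfolding z[rule_format] by simp
  have "z' = z" if "\<forall>y. 2 * G u z' y = dG u w y v + dG u v y w - dG u v w y" for z'
  proof (rule nondegenerate[OF u])
    fix y
    show "G u z' y = G u z y" using that[rule_format, of y] z2[rule_format, of y] by linarith
  qed
  with z2 have "\<forall>y. 2 * G u (loc_christoffel G u v w) y = dG u w y v + dG u v y w - dG u v w y"
    unfolding loc_christoffel_def by (rule theI)
  then show ?thesis by blast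
qed

lemma christoffel_eqI:
  assumes u: "u \<in> S" and "\<And>y. 2 * G u z y = dG u w y v + dG u v y w - dG u v w y"
  shows "loc_christoffel G u v w = z"
  using assms koszul[OF u, of v w] by (intro nondegenerate[OF u]) (metis mult_cancel_left zero_neq_numeral)

lemma christoffel_sym: "u \<in> S \<Longrightarrow> loc_christoffel G u v w = loc_christoffel G u w v"
  by (rule christoffel_eqI) (simp_all add: koszul dG_sym[of u w v])

lemma christoffel_linear_right: "u \<in> S \<Longrightarrow> linear (loc_christoffel G u v)"
  by (intro linearI christoffel_eqI)
    (simp_all add: koszul G_linear_simps dG_linear_simps distrib_left mult.left_commute[of 2] right_diff_distrib)

lemma christoffel_linear_left: "u \<in> S \<Longrightarrow> linear (\<lambda>v. loc_christoffel G u v w)"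
  using christoffel_linear_right[of u w] by (simp add: christoffel_sym[of u _ w])

lemmas christoffel_linear_simps =
  linear_add[OF christoffel_linear_left] linear_add[OF christoffel_linear_right]
  linear_diff[OF christoffel_linear_left] linear_diff[OF christoffel_linear_right]

lemma christoffel_differentiable:
  assumes u: "u \<in> S"
  shows "(\<lambda>a. loc_christoffel G a v w) differentiable (at u)"
proof (rule solution_differentiable[OF u])
  fix a y assume "a \<in> S"
  then show "G a (loc_christoffel G a v w) y = (dG a w y v + dG a v y w - dG a v w y) / 2"
    using koszul[of a v w y] by simp
next
  fix y
  show "(\<lambda>a. (dG a w y v + dG a v y w - dG a v w y) / 2) differentiable (at u)"
    by (intro differentiable_divide differentiable_diff differentiable_add differentiable_const
        smooth_on_differentiable[OF smooth_on_derivative[OF smooth] u]) simp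
qed

lemma loc_riemann_christoffel:
  "loc_riemann G u v w z =
     frechet_derivative (\<lambda>a. loc_christoffel G a w z) (at u) v
       + loc_christoffel G u v (loc_christoffel G u w z)
   - (frechet_derivative (\<lambda>a. loc_christoffel G a v z) (at u) w
       + loc_christoffel G u w (loc_christoffel G u v z))"
  by (simp add: loc_riemann_def loc_nabla_def[abs_def])

end

section \<open>Concurrent fields in one chart\<close>

definition loc_concurrent_at ::
    "('e::euclidean_space \<Rightarrow> 'e \<Rightarrow> 'e \<Rightarrow> real) \<Rightarrow> ('e \<Rightarrow> 'e) \<Rightarrow> 'e \<Rightarrow> bool" where
  "loc_concurrent_at G X u \<longleftrightarrow>
     (\<forall>v. frechet_derivative X (at u) v + loc_christoffel G u v (X u) = v)"

context local_metric
begin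

text \<open>In general \<open>(L\<^sub>X G)(v, w) = G(\<nabla>\<^sub>v X, w) + G(v, \<nabla>\<^sub>w X)\<close>, by symmetry and metric compatibility of the
  connection; both facts enter through the Koszul formula.\<close>

lemma loc_lie_metric_concurrent:
  assumes u: "u \<in> S" and X: "loc_concurrent_at G X u"
  shows "loc_lie_metric G X u v w = 2 * G u v w"
proof -
  have D: "frechet_derivative X (at u) v = v - loc_christoffel G u v (X u)" for v
    using X by (simp add: loc_concurrent_at_def algebra_simps)
  have "2 * G u (loc_christoffel G u v (X u)) w + 2 * G u v (loc_christoffel G u w (X u))
      = 2 * dG u v w (X u)"
    using koszul[OF u, of v "X u" w] koszul[OF u, of w "X u" v]
      sym[OF u, of v "loc_christoffel G u w (X u)"] dG_sym[OF u]
    by simp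
  then show ?thesis
    by (simp add: loc_lie_metric_def loc_bracket_def D G_linear_simps u)
qed

text \<open>Formally \<open>R(v, w) X = \<nabla>\<^sub>v w - \<nabla>\<^sub>w v - [v, w] = 0\<close>.  In coordinates one differentiates the equation
  \<open>D X w = w - \<Gamma>(w, X)\<close> in direction \<open>v\<close>; the antisymmetric part in \<open>v\<close> and \<open>w\<close> of the left
  side vanishes by Schwarz, and that of the right side is the curvature up to sign.\<close>

lemma loc_riemann_concurrent:
  assumes X: "smooth_on S X" "\<And>u. u \<in> S \<Longrightarrow> loc_concurrent_at G X u" and u: "u \<in> S"
  shows "loc_riemann G u v w (X u) = 0"
proof -
  have D: "frechet_derivative X (at a) v = v - loc_christoffel G a v (X a)" if "a \<in> S" for a v
    using X(2)[OF that] by (simp add: loc_concurrent_at_def algebra_simps)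
  have DD: "frechet_derivative (\<lambda>a. frechet_derivative X (at a) w) (at u) v
      = - (frechet_derivative (\<lambda>a. loc_christoffel G a w (X u)) (at u) v
           + loc_christoffel G u w (v - loc_christoffel G u v (X u)))" for v w
  proof -
    have "((\<lambda>a. w - loc_christoffel G a w (X a)) has_derivative (\<lambda>v. 0 -
        (frechet_derivative (\<lambda>a. loc_christoffel G a w (X u)) (at u) v
           + loc_christoffel G u w (frechet_derivative X (at u) v)))) (at u)"
      by (intro has_derivative_diff has_derivative_const has_derivative_linear_family[OF open_S u]
          christoffel_linear_right christoffel_differentiable u smooth_on_differentiable[OF X(1)])
    then have "((\<lambda>a. frechet_derivative X (at a) w) has_derivative (\<lambda>v. 0 -
        (frechet_derivative (\<lambda>a. loc_christoffel G a w (X u)) (at u) v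
           + loc_christoffel G u w (frechet_derivative X (at u) v)))) (at u)"
      by (rule has_derivative_transform_within_open[OF _ open_S u]) (simp add: D)
    then show ?thesis by (simp add: frechet_derivative_eqI D[OF u])
  qed
  show ?thesis
    using second_derivative_symmetric[OF open_S u X(1), of v w]
    unfolding DD loc_riemann_christoffel
    by (simp add: christoffel_linear_simps u christoffel_sym[OF u, of w v] algebra_simps)
qed

lemma loc_ricci_concurrent:
  assumes "smooth_on S X" "\<And>u. u \<in> S \<Longrightarrow> loc_concurrent_at G X u" "u \<in> S"
  shows "loc_ricci G u v (X u) = 0"
  by (simp add: loc_ricci_def loc_riemann_concurrent[OF assms])

end

text \<open>Under a change of coordinates \<open>\<phi>\<close> the Christoffel symbols and the derivative of the field both change
  by the second derivative of \<open>\<phi>\<close>, with opposite signs; by its symmetry the two terms cancel.\<close>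

lemma loc_concurrent_transform:
  fixes G H :: "'e::euclidean_space \<Rightarrow> 'e \<Rightarrow> 'e \<Rightarrow> real"
  assumes "local_metric S G" "local_metric T H"
    and \<phi>: "smooth_on S \<phi>" "\<phi> ` S \<subseteq> T"
    and GH: "\<And>a v w. a \<in> S \<Longrightarrow> G a v w =
      H (\<phi> a) (frechet_derivative \<phi> (at a) v) (frechet_derivative \<phi> (at a) w)"
    and XY: "\<And>a. a \<in> S \<Longrightarrow> Y (\<phi> a) = frechet_derivative \<phi> (at a) (X a)"
    and u: "u \<in> S" and surj: "surj (frechet_derivative \<phi> (at u))"
    and X: "X differentiable (at u)" and Y: "Y differentiable (at (\<phi> u))"
    and conc: "loc_concurrent_at G X u"
  shows "loc_concurrent_at H Y (\<phi> u)"
proof -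
  interpret G: local_metric S G by fact
  interpret H: local_metric T H by fact
  let ?P = "frechet_derivative \<phi> (at u)"
  let ?D = "\<lambda>v w. frechet_derivative (\<lambda>a. frechet_derivative \<phi> (at a) v) (at u) w"
  have \<phi>u: "\<phi> u \<in> T" using \<phi>(2) u by auto
  have \<phi>d: "\<phi> differentiable (at a)" if "a \<in> S" for a using smooth_on_differentiable[OF \<phi>(1) that] .
  have Dd: "(\<lambda>a. frechet_derivative \<phi> (at a) v) differentiable (at u)" for v
    using smooth_on_differentiable[OF smooth_on_derivative[OF \<phi>(1)] u] .
  have Psym: "?D v w = ?D w v" for v w
    by (rule second_derivative_symmetric[OF G.open_S u \<phi>(1)])
  have Plin: "linear (frechet_derivative \<phi> (at a))" if "a \<in> S" for a
    using linear_frechet_derivative[OF \<phi>d[OF that]] .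
  have \<phi>T: "\<phi> a \<in> T" if "a \<in> S" for a using \<phi>(2) that by auto
  have H1: "((\<lambda>a. H (\<phi> a) y z) has_derivative (\<lambda>x. H.dG (\<phi> u) y z (?P x))) (at u)" for y z
    using diff_chain_at[OF differentiable_has_derivative[OF \<phi>d[OF u]] H.has_derivative_G[OF \<phi>u]]
    by (simp add: o_def)
  have H2: "((\<lambda>a. H (\<phi> a) (frechet_derivative \<phi> (at a) v) z) has_derivative
      (\<lambda>x. H.dG (\<phi> u) (?P v) z (?P x) + H (\<phi> u) (?D v x) z)) (at u)" for v z
    using has_derivative_linear_family[OF G.open_S u H.lin_left[OF \<phi>T] differentiableI[OF H1] Dd]
    by (simp add: frechet_derivative_eqI[OF H1])
  have H3: "((\<lambda>a. H (\<phi> a) (frechet_derivative \<phi> (at a) v) (frechet_derivative \<phi> (at a) w)) has_derivative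
      (\<lambda>x. H.dG (\<phi> u) (?P v) (?P w) (?P x) + H (\<phi> u) (?D v x) (?P w) + H (\<phi> u) (?P v) (?D w x))) (at u)"
    for v w
    using has_derivative_linear_family[OF G.open_S u H.lin_right[OF \<phi>T] differentiableI[OF H2] Dd]
    by (simp add: frechet_derivative_eqI[OF H2])
  have dG: "G.dG u v w x =
      H.dG (\<phi> u) (?P v) (?P w) (?P x) + H (\<phi> u) (?D v x) (?P w) + H (\<phi> u) (?P v) (?D w x)" for v w x
    using G.dG_eqI[OF u H3[of v w], of v w] GH by simp
  have chris: "?P (loc_christoffel G u v w) = loc_christoffel H (\<phi> u) (?P v) (?P w) + ?D v w" for v w
  proof (rule H.nondegenerate[OF \<phi>u])
    fix z
    obtain y where y: "z = ?P y" using surj by (metis surj_def)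
    have "2 * H (\<phi> u) (?P (loc_christoffel G u v w)) (?P y) = 2 * G u (loc_christoffel G u v w) y"
      using GH[OF u] by simp
    also have "\<dots> = 2 * H (\<phi> u) (loc_christoffel H (\<phi> u) (?P v) (?P w)) (?P y) + 2 * H (\<phi> u) (?D v w) (?P y)"
      unfolding G.koszul[OF u] dG H.koszul[OF \<phi>u]
      using Psym[of w v] Psym[of y v] Psym[of y w]
        H.sym[OF \<phi>u, of "?D w y" "?P v"] H.sym[OF \<phi>u, of "?D v y" "?P w"]
      by simp
    finally show "H (\<phi> u) (?P (loc_christoffel G u v w)) z
        = H (\<phi> u) (loc_christoffel H (\<phi> u) (?P v) (?P w) + ?D v w) z"
      by (simp add: y H.G_linear_simps \<phi>u)
  qed
  have "((\<lambda>a. frechet_derivative \<phi> (at a) (X a)) has_derivative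
      (\<lambda>v. ?D (X u) v + ?P (frechet_derivative X (at u) v))) (at u)"
    by (rule has_derivative_linear_family[OF G.open_S u Plin Dd X])
  then have "((\<lambda>a. Y (\<phi> a)) has_derivative
      (\<lambda>v. ?D (X u) v + ?P (frechet_derivative X (at u) v))) (at u)"
    by (rule has_derivative_transform_within_open[OF _ G.open_S u]) (simp add: XY)
  moreover have "((\<lambda>a. Y (\<phi> a)) has_derivative (\<lambda>v. frechet_derivative Y (at (\<phi> u)) (?P v))) (at u)"
    using diff_chain_at[OF differentiable_has_derivative[OF \<phi>d[OF u]] differentiable_has_derivative[OF Y]]
    by (simp add: o_def)
  ultimately have DY: "frechet_derivative Y (at (\<phi> u)) (?P v)
      = ?D (X u) v + ?P (frechet_derivative X (at u) v)" for v
    using fun_cong[OF has_derivative_unique] by blast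
  show ?thesis
    unfolding loc_concurrent_at_def
  proof
    fix z
    obtain v where v: "z = ?P v" using surj by (metis surj_def)
    have "frechet_derivative Y (at (\<phi> u)) z + loc_christoffel H (\<phi> u) z (Y (\<phi> u))
        = ?P (frechet_derivative X (at u) v) + ?P (loc_christoffel G u v (X u))"
      using chris[of v "X u"] Psym[of v "X u"] by (simp add: v DY XY u)
    also have "\<dots> = ?P (frechet_derivative X (at u) v + loc_christoffel G u v (X u))"
      using linear_add[OF Plin[OF u]] by simp
    finally show "frechet_derivative Y (at (\<phi> u)) z + loc_christoffel H (\<phi> u) z (Y (\<phi> u)) = z"
      using conc v by (simp add: loc_concurrent_at_def)
  qed
qed

section \<open>Concurrent vector fields on a Riemannian manifold\<close>

lemma local_metric_subset:
  assumes "local_metric S G" "open T" "T \<subseteq> S"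
  shows "local_metric T G"
proof -
  interpret local_metric S G by fact
  show ?thesis
  proof
    show "smooth_on T (\<lambda>u. G u v w)" for v w
      using smooth Ck_on_subset[OF _ assms(3)] unfolding smooth_on_def by blast
  qed (use assms(2,3) bilin sym pos in auto)
qed

context
  fixes M :: "('a::{t2_space, second_countable_topology}, 'e::euclidean_space) manifold"
    and g :: "'a \<Rightarrow> 'e \<Rightarrow> 'e \<Rightarrow> real"
  assumes riem: "riemannian_manifold M g"
begin

private lemma M: "smooth_manifold M"
  using riem by (simp add: riemannian_manifold_def)

lemma metric_bilinear: "x \<in> points M \<Longrightarrow> bilinear (g x)"
  and metric_sym: "x \<in> points M \<Longrightarrow> g x v w = g x w v"
  and metric_pos: "x \<in> points M \<Longrightarrow> v \<noteq> 0 \<Longrightarrow> g x v v > 0"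
  using riem by (auto simp: riemannian_manifold_def riemannian_metric_def)

lemma local_metric_chart:
  assumes c: "c \<in> atlas M"
  shows "local_metric (cimg c) (metric_in M c g)"
proof
  note ch = atlas_is_chart[OF M c]
  show "open (cimg c)" by (rule open_cimg[OF ch])
  show "smooth_on (cimg c) (\<lambda>u. metric_in M c g u v w)" for v w
    using riem c by (simp add: riemannian_manifold_def riemannian_metric_def)
  fix u assume u: "u \<in> cimg c"
  define x where "x = cinv c u"
  have x: "x \<in> cdom c" using ch u by (simp add: x_def)
  have px: "x \<in> points M" using cdom_points[OF M c x] .
  have lin: "linear (from_chart M c x)"
    unfolding from_chart_eq using linear_coord_change[OF M c chart_at_atlas[OF M px] x in_chart_at[OF M px]] .
  have G: "metric_in M c g u = (\<lambda>v w. g x (from_chart M c x v) (from_chart M c x w))"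
    by (simp add: metric_in_def x_def fun_eq_iff)
  show "metric_in M c g u v w = metric_in M c g u w v" for v w
    by (simp add: G metric_sym[OF px])
  have "linear (g x a)" "linear (\<lambda>v. g x v a)" for a
    using metric_bilinear[OF px] by (auto simp: bilinear_def)
  then show "bilinear (metric_in M c g u)"
    using linear_compose[OF lin, unfolded o_def] by (auto simp: G bilinear_def)
  fix v :: 'e assume "v \<noteq> 0"
  moreover have "coord_change (chart_at M x) c x (from_chart M c x v) = v"
    unfolding from_chart_eq using c x px
    by (intro coord_change_inverse[OF M] chart_at_atlas[OF M] in_chart_at[OF M])
  moreover have "linear (coord_change (chart_at M x) c x)"
    using linear_coord_change[OF M chart_at_atlas[OF M px] c in_chart_at[OF M px] x] .
  ultimately have "from_chart M c x v \<noteq> 0" using linear_0 by metis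
  then show "metric_in M c g u v v > 0" using metric_pos[OF px] by (simp add: G)
qed

lemma metric_in_chart_at:
  "x \<in> points M \<Longrightarrow> metric_in M (chart_at M x) g (cmap (chart_at M x) x) v w = g x v w"
  by (simp add: metric_in_def from_chart_eq coord_change_self[OF M] chart_inv atlas_is_chart[OF M]
      chart_at_atlas[OF M] in_chart_at[OF M])

lemma vf_in_chart_at:
  "x \<in> points M \<Longrightarrow> vf_in M (chart_at M x) X (cmap (chart_at M x) x) = X x"
  by (simp add: vf_in_def to_chart_eq coord_change_self[OF M] chart_inv atlas_is_chart[OF M]
      chart_at_atlas[OF M] in_chart_at[OF M])

text \<open>Every tangent vector extends to a global vector field, on which the hypothesis can be used.\<close>

lemma concurrent_in_preferred_chart:
  assumes "concurrent M g \<zeta>" "x \<in> points M"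
  shows "loc_concurrent_at (metric_in M (chart_at M x) g) (vf_in M (chart_at M x) \<zeta>)
    (cmap (chart_at M x) x)"
  unfolding loc_concurrent_at_def
proof
  fix v
  obtain X where X: "smooth_vector_field M X" "X x = v"
    using smooth_vector_field_through[OF M assms(2)] by blast
  then have "nabla M g X \<zeta> x = v" using assms by (simp add: concurrent_def)
  then show "frechet_derivative (vf_in M (chart_at M x) \<zeta>) (at (cmap (chart_at M x) x)) v
      + loc_christoffel (metric_in M (chart_at M x) g) (cmap (chart_at M x) x) v
          (vf_in M (chart_at M x) \<zeta> (cmap (chart_at M x) x)) = v"
    using X(2) vf_in_chart_at[OF assms(2)] by (simp add: nabla_def Let_def loc_nabla_def)
qed

text \<open>The curvature at \<open>x\<close> differentiates \<open>\<nabla>\<zeta>\<close>, so the equation is needed at all points of one fixed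
  chart, whereas the hypothesis speaks of a different preferred chart at each point.\<close>

lemma concurrent_in_chart:
  assumes conc: "concurrent M g \<zeta>" and c: "c \<in> atlas M" and u: "u \<in> cimg c"
  shows "loc_concurrent_at (metric_in M c g) (vf_in M c \<zeta>) u"
proof -
  define y where "y = cinv c u"
  define e where "e = chart_at M y"
  note chc = atlas_is_chart[OF M c]
  have y: "y \<in> cdom c" using chc u by (simp add: y_def)
  have py: "y \<in> points M" using cdom_points[OF M c y] .
  have e: "e \<in> atlas M" "y \<in> cdom e"
    using py by (simp_all add: e_def chart_at_atlas[OF M] in_chart_at[OF M])
  note che = atlas_is_chart[OF M e(1)]
  let ?S = "cmap e ` (cdom e \<inter> cdom c)"
  let ?\<phi> = "cmap c \<circ> cinv e"
  have oS: "open ?S" using open_overlap[OF M e(1) c] .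
  have yS: "cmap e y \<in> ?S" using y e by auto
  have \<phi>y: "?\<phi> (cmap e y) = u" using e che u chc by (simp add: y_def)
  have sm: "smooth_on (cimg d) (vf_in M d \<zeta>)" if "d \<in> atlas M" for d
    using conc that by (simp add: concurrent_def smooth_vector_field_def)
  have "loc_concurrent_at (metric_in M c g) (vf_in M c \<zeta>) (?\<phi> (cmap e y))"
  proof (rule loc_concurrent_transform[where S = ?S and T = "cimg c" and u = "cmap e y"
        and X = "vf_in M e \<zeta>" and G = "metric_in M e g"])
    show "local_metric ?S (metric_in M e g)"
      by (rule local_metric_subset[OF local_metric_chart[OF e(1)] oS]) (auto simp: cimg_def)
    show "local_metric (cimg c) (metric_in M c g)" by (rule local_metric_chart[OF c])
    show "smooth_on ?S ?\<phi>" by (rule smooth_transition[OF M e(1) c])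
    show "?\<phi> ` ?S \<subseteq> cimg c" using che by auto
    show "cmap e y \<in> ?S" by (rule yS)
    show "vf_in M e \<zeta> differentiable (at (cmap e y))"
      using smooth_on_differentiable[OF sm[OF e(1)]] e by simp
    show "vf_in M c \<zeta> differentiable (at (?\<phi> (cmap e y)))"
      unfolding \<phi>y using smooth_on_differentiable[OF sm[OF c] u] .
    show "loc_concurrent_at (metric_in M e g) (vf_in M e \<zeta>) (cmap e y)"
      using concurrent_in_preferred_chart[OF conc py] by (simp add: e_def)
    show "surj (frechet_derivative ?\<phi> (at (cmap e y)))"
      unfolding coord_change_def[symmetric]
      using coord_change_inverse[OF M c e(1) y e(2)] by (metis surj_def)
    fix a assume "a \<in> ?S"
    then obtain z where z: "z \<in> cdom e" "z \<in> cdom c" "a = cmap e z" by blast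
    have pz: "z \<in> points M" using cdom_points[OF M c z(2)] .
    note cz = chart_at_atlas[OF M pz] in_chart_at[OF M pz]
    have D: "frechet_derivative ?\<phi> (at a) = coord_change e c z" by (simp add: coord_change_def z(3))
    have inv: "cinv e a = z" "cinv c (?\<phi> a) = z" using z che chc by simp_all
    show "metric_in M e g a v w = metric_in M c g (?\<phi> a)
        (frechet_derivative ?\<phi> (at a) v) (frechet_derivative ?\<phi> (at a) w)" for v w
      unfolding metric_in_def inv D from_chart_eq
      by (simp add: coord_change_compose[OF M e(1) c cz(1) z(1,2) cz(2)])
    show "vf_in M c \<zeta> (?\<phi> a) = frechet_derivative ?\<phi> (at a) (vf_in M e \<zeta> a)"
      unfolding vf_in_def inv D to_chart_eq
      by (simp add: coord_change_compose[OF M cz(1) e(1) c cz(2) z(1,2)])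
  qed
  then show ?thesis by (simp only: \<phi>y)
qed

lemma lie_metric_concurrent:
  assumes "concurrent M g \<zeta>" "x \<in> points M"
  shows "lie_metric M g \<zeta> x v w = 2 * g x v w"
  using local_metric.loc_lie_metric_concurrent[OF local_metric_chart[OF chart_at_atlas[OF M assms(2)]]
      cmap_in_cimg[OF in_chart_at[OF M assms(2)]] concurrent_in_preferred_chart[OF assms]]
  by (simp add: lie_metric_def Let_def metric_in_chart_at[OF assms(2)])

lemma ricci_concurrent:
  assumes "concurrent M g \<zeta>" "x \<in> points M"
  shows "ricci M g x v (\<zeta> x) = 0"
proof -
  let ?c = "chart_at M x"
  have c: "?c \<in> atlas M" using chart_at_atlas[OF M assms(2)] .
  have "smooth_on (cimg ?c) (vf_in M ?c \<zeta>)"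
    using assms(1) c by (simp add: concurrent_def smooth_vector_field_def)
  from local_metric.loc_ricci_concurrent[OF local_metric_chart[OF c] this
      concurrent_in_chart[OF assms(1) c] cmap_in_cimg[OF in_chart_at[OF M assms(2)]], of v]
  show ?thesis by (simp add: ricci_def Let_def vf_in_chart_at[OF assms(2)])
qed

text \<open>A concurrent field vanishing on an open set would have \<open>\<nabla>\<zeta> = 0\<close> there, whereas \<open>\<nabla>\<^sub>v \<zeta> = v\<close>.\<close>

lemma concurrent_nonzero_dense:
  assumes conc: "concurrent M g \<zeta>" and x: "x \<in> points M"
  shows "x \<in> closure {y \<in> points M. \<zeta> y \<noteq> 0}"
proof (rule ccontr)
  let ?N = "{y \<in> points M. \<zeta> y \<noteq> 0}"
  assume "x \<notin> closure ?N"
  then have xA: "x \<in> - closure ?N" by simp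
  define c where "c = chart_at M x"
  have c: "c \<in> atlas M" "x \<in> cdom c" using x by (simp_all add: c_def chart_at_atlas[OF M] in_chart_at[OF M])
  note ch = atlas_is_chart[OF M c(1)]
  let ?S = "cmap c ` (cdom c \<inter> - closure ?N)" and ?u = "cmap c x"
  have oS: "open ?S" using ch by (intro open_chart_image) auto
  have zero: "vf_in M c \<zeta> a = 0" if aS: "a \<in> ?S" for a
  proof -
    obtain z where z: "z \<in> cdom c" "z \<notin> closure ?N" "a = cmap c z" using aS by blast
    have pz: "z \<in> points M" using cdom_points[OF M c(1) z(1)] .
    have "z \<notin> ?N" using z(2) by (rule contra_subsetD[OF closure_subset])
    then have "\<zeta> z = 0" using pz by simp
    then show ?thesis
      using linear_0[OF linear_coord_change[OF M chart_at_atlas[OF M pz] c(1) in_chart_at[OF M pz] z(1)]] ch z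
      by (simp add: vf_in_def to_chart_eq)
  qed
  have "((\<lambda>_. 0) has_derivative (\<lambda>_. 0 :: 'e)) (at ?u)" by simp
  then have "(vf_in M c \<zeta> has_derivative (\<lambda>_. 0)) (at ?u)"
    by (rule has_derivative_transform_within_open[OF _ oS]) (use c xA zero in auto)
  then have D: "frechet_derivative (vf_in M c \<zeta>) (at ?u) = (\<lambda>_. 0)" by (rule frechet_derivative_eqI)
  interpret local_metric "cimg c" "metric_in M c g" by (rule local_metric_chart[OF c(1)])
  have u: "?u \<in> cimg c" using c by simp
  have z: "vf_in M c \<zeta> ?u = 0" using zero[of ?u] c(2) xA by blast
  have "v = 0" for v :: 'e
    using concurrent_in_chart[OF conc c(1) u] linear_0[OF christoffel_linear_right[OF u, of v]]
    by (simp add: loc_concurrent_at_def D z)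
  then show False using nonzero_Basis SOME_Basis by metis
qed

lemma smooth_function_continuous:
  assumes h: "smooth_function M h"
  shows "continuous_on (points M) h"
  unfolding points_def
proof (rule continuous_on_open_UN)
  fix c assume c: "c \<in> atlas M"
  note ch = atlas_is_chart[OF M c]
  show "open (cdom c)" by (rule open_cdom[OF ch])
  have "continuous_on (cimg c) (h \<circ> cinv c)"
    using h c by (intro smooth_on_imp_continuous_on) (simp add: smooth_function_def)
  moreover have "continuous_on (cdom c) (cmap c)"
    using homeomorphism_cont1[OF chart_homeomorphism[OF ch]] .
  ultimately have "continuous_on (cdom c) (\<lambda>x. (h \<circ> cinv c) (cmap c x))"
    by (rule continuous_on_compose2) auto
  then show "continuous_on (cdom c) h"
    by (rule continuous_on_eq) (simp add: ch)
qed

text \<open>Since \<open>L\<^sub>\<zeta> g = 2 g\<close>, the soliton equation says \<open>Ric = (\<mu>/2 - 1) g\<close>, and \<open>Ric(\<zeta>, \<zeta>) = 0\<close> forces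
  \<open>\<mu> = 2\<close> on the dense set where \<open>\<zeta>\<close> is nonzero, hence everywhere by continuity.\<close>

theorem concurrent_soliton:
  assumes sol: "conformal_ricci_soliton M g \<mu> \<zeta>" and conc: "concurrent M g \<zeta>"
    and cont: "continuous_on (points M) \<mu>"
  shows "\<And>x. x \<in> points M \<Longrightarrow> \<mu> x = 2" and "ricci_flat M g"
proof -
  have ric: "2 * g x v w + 2 * ricci M g x v w = \<mu> x * g x v w" if "x \<in> points M" for x v w
    using sol that by (simp add: conformal_ricci_soliton_def lie_metric_concurrent[OF conc])
  have nz: "\<mu> x = 2" if "x \<in> points M" "\<zeta> x \<noteq> 0" for x
    using ric[OF that(1), of "\<zeta> x" "\<zeta> x"] ricci_concurrent[OF conc that(1)] metric_pos[OF that]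
    by simp
  show \<mu>: "\<mu> x = 2" if x: "x \<in> points M" for x
  proof (rule ccontr)
    assume ne: "\<mu> x \<noteq> 2"
    have op: "open (points M)"
      unfolding points_def using atlas_is_chart[OF M] by (auto intro: open_cdom)
    let ?A = "points M \<inter> \<mu> -` (- {2})"
    have "open ?A" using continuous_open_preimage[OF cont op, of "- {2}"] by auto
    moreover have "x \<in> ?A" using x ne by simp
    ultimately show False
      using concurrent_nonzero_dense[OF conc x] nz unfolding closure_iff_nhds_not_empty by blast
  qed
  show "ricci_flat M g"
    unfolding ricci_flat_def using ric \<mu> by fastforce
qed

end

text \<open>A constant potential with \<open>\<nu> = 0\<close> is enough.\<close>

lemma ricci_flat_gradient_soliton:
  assumes "ricci_flat N h"
  shows "admits_conformal_gradient_ricci_soliton N h"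
  unfolding admits_conformal_gradient_ricci_soliton_def
proof (intro exI conjI ballI allI)
  show "smooth_function N (\<lambda>_. 0)" by (simp add: smooth_function_def smooth_on_def o_def)
  show "2 * hessian N h (\<lambda>_. 0) x v w + 2 * ricci N h x v w = 0 * h x v w" if "x \<in> points N" for x v w
    using assms that by (simp add: ricci_flat_def hessian_def Let_def loc_hessian_def o_def)
qed

section \<open>Ricci curvature of a product metric in one chart\<close>

lemma has_derivative_pair_map:
  assumes "(h has_derivative h') (at (fst p))" "(k has_derivative k') (at (snd p))"
  shows "((\<lambda>z. (h (fst z), k (snd z))) has_derivative (\<lambda>v. (h' (fst v), k' (snd v)))) (at p)"
  using diff_chain_at[OF has_derivative_fst[OF has_derivative_ident] assms(1)]
    diff_chain_at[OF has_derivative_snd[OF has_derivative_ident] assms(2)]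
  by (intro has_derivative_Pair) (simp_all add: o_def)

text \<open>The Koszul formula is linear in the metric, and a constant factor cancels from it.  So the Christoffel
  symbols of the product are the pairs of those of the factors, and the curvature and its trace split accordingly.\<close>

lemma product_metric_ricci:
  fixes G :: "'e::euclidean_space \<Rightarrow> 'e \<Rightarrow> 'e \<Rightarrow> real" and H :: "'f::euclidean_space \<Rightarrow> 'f \<Rightarrow> 'f \<Rightarrow> real"
  assumes "local_metric S G" "local_metric T H" "local_metric (S \<times> T) K"
    and K: "\<And>p v w. p \<in> S \<times> T \<Longrightarrow>
      K p v w = G (fst p) (fst v) (fst w) + k * H (snd p) (snd v) (snd w)"
    and p: "p \<in> S \<times> T"
  shows "loc_ricci K p v w = loc_ricci G (fst p) (fst v) (fst w) + loc_ricci H (snd p) (snd v) (snd w)"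
proof -
  interpret G: local_metric S G by fact
  interpret H: local_metric T H by fact
  interpret K: local_metric "S \<times> T" K by fact
  have dK: "K.dG p v w x = G.dG (fst p) (fst v) (fst w) (fst x) + k * H.dG (snd p) (snd v) (snd w) (snd x)"
    if "p \<in> S \<times> T" for p v w x
  proof -
    have m: "fst p \<in> S" "snd p \<in> T" using that by auto
    have "((\<lambda>z. G (fst z) (fst v) (fst w)) has_derivative (\<lambda>x. G.dG (fst p) (fst v) (fst w) (fst x))) (at p)"
      using diff_chain_at[OF has_derivative_fst[OF has_derivative_ident] G.has_derivative_G[OF m(1)]]
      by (simp add: o_def)
    moreover have "((\<lambda>z. k * H (snd z) (snd v) (snd w)) has_derivative
        (\<lambda>x. k * H.dG (snd p) (snd v) (snd w) (snd x))) (at p)"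
      using diff_chain_at[OF has_derivative_snd[OF has_derivative_ident] H.has_derivative_G[OF m(2)]]
      by (intro has_derivative_mult_right) (simp add: o_def)
    ultimately have "((\<lambda>z. G (fst z) (fst v) (fst w) + k * H (snd z) (snd v) (snd w)) has_derivative
        (\<lambda>x. G.dG (fst p) (fst v) (fst w) (fst x) + k * H.dG (snd p) (snd v) (snd w) (snd x))) (at p)"
      by (rule has_derivative_add)
    from K.dG_eqI[OF that this, of v w] show ?thesis by (simp add: K)
  qed
  have chris: "loc_christoffel K p v w =
      (loc_christoffel G (fst p) (fst v) (fst w), loc_christoffel H (snd p) (snd v) (snd w))"
    if "p \<in> S \<times> T" for p v w
  proof (rule K.christoffel_eqI[OF that])
    fix y
    have m: "fst p \<in> S" "snd p \<in> T" using that by auto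
    show "2 * K p (loc_christoffel G (fst p) (fst v) (fst w), loc_christoffel H (snd p) (snd v) (snd w)) y
        = K.dG p w y v + K.dG p v y w - K.dG p v w y"
      using G.koszul[OF m(1), of "fst v" "fst w" "fst y"]
        arg_cong[OF H.koszul[OF m(2), of "snd v" "snd w" "snd y"], of "(*) k"]
      by (simp add: dK[OF that] K[OF that] algebra_simps)
  qed
  have m: "fst p \<in> S" "snd p \<in> T" using p by auto
  have dchris: "frechet_derivative (\<lambda>a. loc_christoffel K a v w) (at p) x =
      (frechet_derivative (\<lambda>a. loc_christoffel G a (fst v) (fst w)) (at (fst p)) (fst x),
       frechet_derivative (\<lambda>a. loc_christoffel H a (snd v) (snd w)) (at (snd p)) (snd x))" for v w x
  proof -
    have "((\<lambda>a. (loc_christoffel G (fst a) (fst v) (fst w), loc_christoffel H (snd a) (snd v) (snd w)))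
      has_derivative (\<lambda>x.
       (frechet_derivative (\<lambda>a. loc_christoffel G a (fst v) (fst w)) (at (fst p)) (fst x),
        frechet_derivative (\<lambda>a. loc_christoffel H a (snd v) (snd w)) (at (snd p)) (snd x)))) (at p)"
      by (intro has_derivative_pair_map differentiable_has_derivative
          G.christoffel_differentiable H.christoffel_differentiable m)
    then have "((\<lambda>a. loc_christoffel K a v w) has_derivative (\<lambda>x.
       (frechet_derivative (\<lambda>a. loc_christoffel G a (fst v) (fst w)) (at (fst p)) (fst x),
        frechet_derivative (\<lambda>a. loc_christoffel H a (snd v) (snd w)) (at (snd p)) (snd x)))) (at p)"
      by (rule has_derivative_transform_within_open[OF _ K.open_S p]) (simp add: chris)
    then show ?thesis by (simp add: frechet_derivative_eqI)
  qed
  have riem: "loc_riemann K p b v w =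
      (loc_riemann G (fst p) (fst b) (fst v) (fst w), loc_riemann H (snd p) (snd b) (snd v) (snd w))" for b
    by (simp add: K.loc_riemann_christoffel G.loc_riemann_christoffel H.loc_riemann_christoffel
        chris[OF p] dchris)
  have inj: "inj_on (\<lambda>u. (u :: 'e, 0 :: 'f)) Basis" "inj_on (\<lambda>u. (0 :: 'e, u :: 'f)) Basis"
    by (auto intro!: inj_onI)
  have "loc_ricci K p v w = (\<Sum>b\<in>Basis. loc_riemann K p (b, 0) v w \<bullet> (b, 0))
      + (\<Sum>b\<in>Basis. loc_riemann K p (0, b) v w \<bullet> (0, b))"
    unfolding loc_ricci_def Basis_prod_def
    by (subst sum.union_disjoint) (auto simp: sum.reindex[OF inj(1)] sum.reindex[OF inj(2)])
  then show ?thesis by (simp add: riem loc_ricci_def)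
qed

section \<open>Warped products\<close>

lemma smooth_on_fst:
  assumes "open S" "open T" "smooth_on S h"
  shows "smooth_on (S \<times> T) (\<lambda>z. h (fst z))"
  unfolding smooth_on_def
proof
  fix n
  show "Ck_on n (S \<times> T) (\<lambda>z. h (fst z))"
    by (rule Ck_on_compose[OF open_Times[OF assms(1,2)] assms(1) _ Ck_on_linear[OF _ bounded_linear_fst]])
      (use assms in \<open>auto simp: smooth_on_def open_Times\<close>)
qed

lemma smooth_on_snd:
  assumes "open S" "open T" "smooth_on T h"
  shows "smooth_on (S \<times> T) (\<lambda>z. h (snd z))"
  unfolding smooth_on_def
proof
  fix n
  show "Ck_on n (S \<times> T) (\<lambda>z. h (snd z))"
    by (rule Ck_on_compose[OF open_Times[OF assms(1,2)] assms(2) _ Ck_on_linear[OF _ bounded_linear_snd]])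
      (use assms in \<open>auto simp: smooth_on_def open_Times\<close>)
qed

lemma prod_chart_simps [simp]:
  "cdom (prod_chart c d) = cdom c \<times> cdom d"
  "cmap (prod_chart c d) = map_prod (cmap c) (cmap d)"
  "cinv (prod_chart c d) = map_prod (cinv c) (cinv d)"
  "cimg (prod_chart c d) = cimg c \<times> cimg d"
  by (auto simp: prod_chart_def cimg_def)

lemma continuous_on_map_prod:
  assumes "continuous_on A h" "continuous_on A' h'"
  shows "continuous_on (A \<times> A') (map_prod h h')"
  unfolding map_prod_def case_prod_beta
  by (intro continuous_intros continuous_on_compose2[OF assms(1)] continuous_on_compose2[OF assms(2)]) auto

lemma is_chart_prod:
  assumes c: "is_chart c" and d: "is_chart d"
  shows "is_chart (prod_chart c d)"
proof -
  have "homeomorphism (cdom c \<times> cdom d) (cimg c \<times> cimg d)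
      (map_prod (cmap c) (cmap d)) (map_prod (cinv c) (cinv d))"
    using c d by (intro homeomorphismI continuous_on_map_prod continuous_on_cinv
        homeomorphism_cont1[OF chart_homeomorphism]) auto
  then show ?thesis
    by (simp add: is_chart_def[of "prod_chart c d"] open_Times c d open_cdom open_cimg)
qed

lemma points_prod_manifold: "points (prod_manifold B F) = points B \<times> points F"
  by (auto simp: points_def prod_manifold_def) (metis prod_chart_simps(1) mem_Sigma_iff)+

lemma chart_at_prod_manifold [simp]:
  "chart_at (prod_manifold B F) (x, y) = prod_chart (chart_at B x) (chart_at F y)"
  by (simp add: prod_manifold_def)

context
  fixes B :: "('a::{t2_space, second_countable_topology}, 'e::euclidean_space) manifold"
    and F :: "('b::{t2_space, second_countable_topology}, 'f::euclidean_space) manifold"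
  assumes B: "smooth_manifold B" and F: "smooth_manifold F"
begin

lemma smooth_manifold_prod: "smooth_manifold (prod_manifold B F)"
  unfolding smooth_manifold_def
proof (intro conjI ballI)
  show "points (prod_manifold B F) \<noteq> {}"
    using B F by (auto simp: points_prod_manifold smooth_manifold_def)
  show "is_chart c" if "c \<in> atlas (prod_manifold B F)" for c
    using that atlas_is_chart[OF B] atlas_is_chart[OF F] by (auto simp: prod_manifold_def is_chart_prod)
  fix z assume z: "z \<in> points (prod_manifold B F)"
  obtain x y where xy: "z = (x, y)" "x \<in> points B" "y \<in> points F"
    using z by (auto simp: points_prod_manifold)
  show "chart_at (prod_manifold B F) z \<in> atlas (prod_manifold B F)"
    using xy chart_at_atlas[OF B] chart_at_atlas[OF F] by (auto simp: prod_manifold_def)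
  show "z \<in> cdom (chart_at (prod_manifold B F) z)"
    using xy in_chart_at[OF B] in_chart_at[OF F] by simp
next
  fix c' d' assume "c' \<in> atlas (prod_manifold B F)" "d' \<in> atlas (prod_manifold B F)"
  then obtain c cc d dd where c: "c' = prod_chart c cc" "c \<in> atlas B" "cc \<in> atlas F"
    and d: "d' = prod_chart d dd" "d \<in> atlas B" "dd \<in> atlas F"
    by (auto simp: prod_manifold_def)
  let ?S = "cmap c ` (cdom c \<inter> cdom d)" and ?T = "cmap cc ` (cdom cc \<inter> cdom dd)"
  have oS: "open ?S" and oT: "open ?T"
    using open_overlap[OF B c(2) d(2)] open_overlap[OF F c(3) d(3)] .
  note o = open_Times[OF oS oT]
  have "Ck_on n (?S \<times> ?T) (\<lambda>z. ((cmap d \<circ> cinv c) (fst z), 0) + (0, (cmap dd \<circ> cinv cc) (snd z)))" for n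
  proof (rule Ck_on_add[OF o])
    have "Ck_on n (?S \<times> ?T) (\<lambda>z. (cmap d \<circ> cinv c) (fst z))"
      using smooth_on_fst[OF oS oT smooth_transition[OF B c(2) d(2)]] unfolding smooth_on_def by blast
    then show "Ck_on n (?S \<times> ?T) (\<lambda>z. ((cmap d \<circ> cinv c) (fst z), 0 :: 'f))"
      by (rule Ck_on_bounded_linear[OF o, rotated])
        (intro bounded_linear_Pair bounded_linear_ident bounded_linear_zero)
    have "Ck_on n (?S \<times> ?T) (\<lambda>z. (cmap dd \<circ> cinv cc) (snd z))"
      using smooth_on_snd[OF oS oT smooth_transition[OF F c(3) d(3)]] unfolding smooth_on_def by blast
    then show "Ck_on n (?S \<times> ?T) (\<lambda>z. (0 :: 'e, (cmap dd \<circ> cinv cc) (snd z)))"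
      by (rule Ck_on_bounded_linear[OF o, rotated])
        (intro bounded_linear_Pair bounded_linear_ident bounded_linear_zero)
  qed
  moreover have "(\<lambda>z. ((cmap d \<circ> cinv c) (fst z), 0) + (0, (cmap dd \<circ> cinv cc) (snd z))) = cmap d' \<circ> cinv c'"
    by (auto simp: c(1) d(1) fun_eq_iff)
  moreover have "cmap c' ` (cdom c' \<inter> cdom d') = ?S \<times> ?T"
    by (simp add: c(1) d(1) Times_Int_Times map_prod_surj_on)
  ultimately show "smooth_on (cmap c' ` (cdom c' \<inter> cdom d')) (cmap d' \<circ> cinv c')"
    by (simp add: smooth_on_def)
qed

lemma coord_change_prod:
  assumes "c \<in> atlas B" "d \<in> atlas B" "x \<in> cdom c" "x \<in> cdom d"
    and "cc \<in> atlas F" "dd \<in> atlas F" "y \<in> cdom cc" "y \<in> cdom dd"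
  shows "coord_change (prod_chart c cc) (prod_chart d dd) (x, y) v
    = (coord_change c d x (fst v), coord_change cc dd y (snd v))"
proof -
  have "((\<lambda>z. ((cmap d \<circ> cinv c) (fst z), (cmap dd \<circ> cinv cc) (snd z))) has_derivative
      (\<lambda>v. (coord_change c d x (fst v), coord_change cc dd y (snd v)))) (at (cmap c x, cmap cc y))"
    by (rule has_derivative_pair_map)
      (simp_all only: fst_conv snd_conv has_derivative_transition[OF B assms(1-4)] has_derivative_transition[OF F assms(5-8)])
  moreover have "(\<lambda>z. ((cmap d \<circ> cinv c) (fst z), (cmap dd \<circ> cinv cc) (snd z)))
      = cmap (prod_chart d dd) \<circ> cinv (prod_chart c cc)"
    by (auto simp: fun_eq_iff)
  ultimately show ?thesis
    unfolding coord_change_def[of "prod_chart c cc"] by (simp add: frechet_derivative_eqI)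
qed

lemma warped_metric_in_chart:
  assumes c: "c \<in> atlas B" and d: "d \<in> atlas F" and p: "p \<in> cimg c \<times> cimg d"
  shows "metric_in (prod_manifold B F) (prod_chart c d) (warped_metric gB f gF) p v w =
    metric_in B c gB (fst p) (fst v) (fst w)
      + (f (cinv c (fst p)))\<^sup>2 * metric_in F d gF (snd p) (snd v) (snd w)"
proof -
  define x y where xy: "x = cinv c (fst p)" "y = cinv d (snd p)"
  have x: "x \<in> cdom c" and y: "y \<in> cdom d"
    using p atlas_is_chart[OF B c] atlas_is_chart[OF F d] by (auto simp: xy)
  have px: "x \<in> points B" and py: "y \<in> points F"
    using cdom_points[OF B c x] cdom_points[OF F d y] .
  have inv: "cinv (prod_chart c d) p = (x, y)" by (cases p) (simp add: xy)
  show ?thesis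
    unfolding metric_in_def inv from_chart_eq chart_at_prod_manifold warped_metric_def xy[symmetric] fst_conv snd_conv
      coord_change_prod[OF c chart_at_atlas[OF B px] x in_chart_at[OF B px] d chart_at_atlas[OF F py] y in_chart_at[OF F py]]
    by simp
qed

end

lemma riemannian_manifold_warped_product:
  fixes B :: "('a::{t2_space, second_countable_topology}, 'e::euclidean_space) manifold"
    and F :: "('b::{t2_space, second_countable_topology}, 'f::euclidean_space) manifold"
  assumes rB: "riemannian_manifold B gB" and rF: "riemannian_manifold F gF" and f: "warping_function B f"
  shows "riemannian_manifold (prod_manifold B F) (warped_metric gB f gF)"
  unfolding riemannian_manifold_def riemannian_metric_def
proof (intro conjI ballI allI impI)
  have B: "smooth_manifold B" and F: "smooth_manifold F"
    using rB rF by (simp_all add: riemannian_manifold_def)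
  show "smooth_manifold (prod_manifold B F)" by (rule smooth_manifold_prod[OF B F])
  {
    fix z assume "z \<in> points (prod_manifold B F)"
    then have z: "fst z \<in> points B" "snd z \<in> points F" by (auto simp: points_prod_manifold)
    note bl = metric_bilinear[OF rB z(1)] metric_bilinear[OF rF z(2)]
    show "bilinear (warped_metric gB f gF z)"
      using bl by (auto simp: bilinear_def warped_metric_def linear_iff algebra_simps)
    show "warped_metric gB f gF z v w = warped_metric gB f gF z w v" for v w
      by (simp add: warped_metric_def metric_sym[OF rB z(1), of "fst v"] metric_sym[OF rF z(2), of "snd v"])
    have nB: "gB (fst z) v v \<ge> 0" for v
      using metric_pos[OF rB z(1), of v] bilinear_lzero[OF bl(1)] by (cases "v = 0") auto
    have nF: "gF (snd z) v v \<ge> 0" for v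
      using metric_pos[OF rF z(2), of v] bilinear_lzero[OF bl(2)] by (cases "v = 0") auto
    have fp: "f (fst z) > 0" using f z(1) by (simp add: warping_function_def)
    fix v :: "'e \<times> 'f" assume "v \<noteq> 0"
    then consider "fst v \<noteq> 0" | "snd v \<noteq> 0" by (auto simp: prod_eq_iff)
    then show "warped_metric gB f gF z v v > 0"
    proof cases
      case 1
      then show ?thesis
        unfolding warped_metric_def using metric_pos[OF rB z(1)] nF by (intro add_pos_nonneg) auto
    next
      case 2
      then show ?thesis
        unfolding warped_metric_def using metric_pos[OF rF z(2)] nB fp by (intro add_nonneg_pos) auto
    qed
  }
  fix c' and v w :: "'e \<times> 'f" assume "c' \<in> atlas (prod_manifold B F)"
  then obtain c d where c': "c' = prod_chart c d" and c: "c \<in> atlas B" and d: "d \<in> atlas F"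
    by (auto simp: prod_manifold_def)
  have oc: "open (cimg c)" and od: "open (cimg d)"
    using open_cimg atlas_is_chart[OF B c] atlas_is_chart[OF F d] by auto
  note o = open_Times[OF oc od]
  have sB: "smooth_on (cimg c) (\<lambda>u. metric_in B c gB u (fst v) (fst w))"
    and sF: "smooth_on (cimg d) (\<lambda>u. metric_in F d gF u (snd v) (snd w))"
    and sf: "smooth_on (cimg c) (f \<circ> cinv c)"
    using local_metric.smooth[OF local_metric_chart[OF rB c]] local_metric.smooth[OF local_metric_chart[OF rF d]]
      f c by (auto simp: warping_function_def smooth_function_def)
  have Ck: "Ck_on n (cimg c \<times> cimg d) (\<lambda>p. metric_in B c gB (fst p) (fst v) (fst w)
      + ((f \<circ> cinv c) (fst p) * (f \<circ> cinv c) (fst p)) * metric_in F d gF (snd p) (snd v) (snd w))" for n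
    using smooth_on_fst[OF oc od sB] smooth_on_snd[OF oc od sF] smooth_on_fst[OF oc od sf]
    unfolding smooth_on_def
    by (intro Ck_on_add[OF o] Ck_on_bilinear[OF o bounded_bilinear_mult]) blast+
  show "smooth_on (cimg c') (\<lambda>u. metric_in (prod_manifold B F) c' (warped_metric gB f gF) u v w)"
    unfolding smooth_on_def
  proof
    fix n
    show "Ck_on n (cimg c') (\<lambda>u. metric_in (prod_manifold B F) c' (warped_metric gB f gF) u v w)"
      unfolding c' prod_chart_simps
      by (rule Ck_on_cong[OF o _ Ck])
        (simp add: warped_metric_in_chart[OF B F c d] power2_eq_square)
  qed
qed

lemma ricci_product:
  fixes B :: "('a::{t2_space, second_countable_topology}, 'e::euclidean_space) manifold"
    and F :: "('b::{t2_space, second_countable_topology}, 'f::euclidean_space) manifold"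
  assumes rB: "riemannian_manifold B gB" and rF: "riemannian_manifold F gF" and f: "warping_function B f"
    and const: "f constant_on points B" and x: "x \<in> points B" and y: "y \<in> points F"
  shows "ricci (prod_manifold B F) (warped_metric gB f gF) (x, y) v w
    = ricci B gB x (fst v) (fst w) + ricci F gF y (snd v) (snd w)"
proof -
  have B: "smooth_manifold B" and F: "smooth_manifold F"
    using rB rF by (simp_all add: riemannian_manifold_def)
  let ?c = "chart_at B x" and ?d = "chart_at F y"
  let ?M = "prod_manifold B F" and ?g = "warped_metric gB f gF"
  have c: "?c \<in> atlas B" and d: "?d \<in> atlas F"
    using chart_at_atlas[OF B x] chart_at_atlas[OF F y] .
  obtain k where k: "\<And>x. x \<in> points B \<Longrightarrow> f x = k" using const by (auto simp: constant_on_def)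
  have "prod_chart ?c ?d \<in> atlas ?M" using c d by (auto simp: prod_manifold_def)
  from local_metric_chart[OF riemannian_manifold_warped_product[OF rB rF f] this]
  have M: "local_metric (cimg ?c \<times> cimg ?d) (metric_in ?M (prod_chart ?c ?d) ?g)" by simp
  have K: "metric_in ?M (prod_chart ?c ?d) ?g p v w =
      metric_in B ?c gB (fst p) (fst v) (fst w) + k\<^sup>2 * metric_in F ?d gF (snd p) (snd v) (snd w)"
    if "p \<in> cimg ?c \<times> cimg ?d" for p v w
  proof -
    have "cinv ?c (fst p) \<in> points B"
      using that by (intro cdom_points[OF B c] cinv_in_cdom atlas_is_chart[OF B c]) auto
    then show ?thesis using warped_metric_in_chart[OF B F c d that] k by simp
  qed
  have "(cmap ?c x, cmap ?d y) \<in> cimg ?c \<times> cimg ?d"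
    using in_chart_at[OF B x] in_chart_at[OF F y] by simp
  from product_metric_ricci[OF local_metric_chart[OF rB c] local_metric_chart[OF rF d] M K this]
  show ?thesis by (simp add: ricci_def Let_def)
qed

theorem theorem4p2:
  fixes B :: "('a::{t2_space, second_countable_topology}, 'e::euclidean_space) manifold"
    and F :: "('b::{t2_space, second_countable_topology}, 'f::euclidean_space) manifold"
    and gB :: "'a \<Rightarrow> 'e \<Rightarrow> 'e \<Rightarrow> real"
    and gF :: "'b \<Rightarrow> 'f \<Rightarrow> 'f \<Rightarrow> real"
    and f :: "'a \<Rightarrow> real"
    and m n :: nat
    and M :: "('a \<times> 'b, 'e \<times> 'f) manifold"
    and g :: "'a \<times> 'b \<Rightarrow> 'e \<times> 'f \<Rightarrow> 'e \<times> 'f \<Rightarrow> real"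
    and \<xi>B :: "'a \<Rightarrow> 'e"
    and \<xi>F :: "'b \<Rightarrow> 'f"
    and \<xi> :: "'a \<times> 'b \<Rightarrow> 'e \<times> 'f"
    and l :: real
    and p \<mu> :: "'a \<times> 'b \<Rightarrow> real"
  assumes "riemannian_manifold B gB"
    and "riemannian_manifold F gF"
    and "DIM('e) = m"
    and "DIM('f) = n"
    and "warping_function B f"
    and "M = prod_manifold B F"
    and "g = warped_metric gB f gF"
    and "smooth_vector_field B \<xi>B"
    and "smooth_vector_field F \<xi>F"
    and "\<xi> = (\<lambda>z. lift_base \<xi>B z + lift_fiber \<xi>F z)"
    and "smooth_function M p"
    and "\<mu> = soliton_scalar n l p"
    and "conformal_ricci_soliton M g \<mu> \<xi>"
    and "concurrent M g \<xi>"
    and "f constant_on points B"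
    and "concurrent B gB \<xi>B"
    and "concurrent F gF \<xi>F"
  shows "(\<forall>z\<in>points M.
            (expanding l \<longleftrightarrow> p z / 2 + 1 / real n + 1 < 0)
          \<and> (steady l \<longleftrightarrow> p z / 2 + 1 / real n + 1 = 0)
          \<and> (shrinking l \<longleftrightarrow> p z / 2 + 1 / real n + 1 > 0))
       \<and> (ricci_flat M g \<and> ricci_flat B gB \<and> ricci_flat F gF)
       \<and> (admits_conformal_gradient_ricci_soliton M g
          \<and> admits_conformal_gradient_ricci_soliton B gB
          \<and> admits_conformal_gradient_ricci_soliton F gF)"
proof (intro conjI)
  have rM: "riemannian_manifold M g"
    using riemannian_manifold_warped_product assms(1,2,5-7) by blast
  have "continuous_on (points M) \<mu>"
    unfolding assms(12) soliton_scalar_def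
    by (intro continuous_intros smooth_function_continuous[OF rM assms(11)])
  note M2 = concurrent_soliton[OF rM assms(13,14) this]
  have M: "points M = points B \<times> points F" using assms(6) by (simp add: points_prod_manifold)
  \<comment> \<open>Evaluating one factor on its own concurrent field makes the Ricci term of that factor vanish,
    so the other factor is Ricci flat too.\<close>
  have split: "ricci B gB x (fst v) (fst w) + ricci F gF y (snd v) (snd w) = 0"
    if "x \<in> points B" "y \<in> points F" for x y v w
    using ricci_product[OF assms(1,2,5,15) that, of v w]
      M2(2)[unfolded ricci_flat_def, rule_format, of "(x, y)" v w] that
    by (simp add: M flip: assms(6,7))
  have ne: "points B \<noteq> {}" "points F \<noteq> {}"
    using assms(1,2) by (auto simp: riemannian_manifold_def smooth_manifold_def)
  show flat: "ricci_flat M g" by (rule M2(2))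
  show flatB: "ricci_flat B gB"
    unfolding ricci_flat_def
  proof (intro ballI allI)
    fix x v w assume x: "x \<in> points B"
    obtain y where y: "y \<in> points F" using ne by blast
    show "ricci B gB x v w = 0"
      using split[OF x y, of "(v, 0)" "(w, \<xi>F y)"] ricci_concurrent[OF assms(2,17) y] by simp
  qed
  show flatF: "ricci_flat F gF"
    unfolding ricci_flat_def
  proof (intro ballI allI)
    fix y v w assume y: "y \<in> points F"
    obtain x where x: "x \<in> points B" using ne by blast
    show "ricci F gF y v w = 0"
      using split[OF x y, of "(0, v)" "(\<xi>B x, w)"] ricci_concurrent[OF assms(1,16) x] by simp
  qed
  show "admits_conformal_gradient_ricci_soliton M g" "admits_conformal_gradient_ricci_soliton B gB"
    "admits_conformal_gradient_ricci_soliton F gF"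
    using flat flatB flatF by (auto intro: ricci_flat_gradient_soliton)
  show "\<forall>z\<in>points M. (expanding l \<longleftrightarrow> p z / 2 + 1 / real n + 1 < 0)
      \<and> (steady l \<longleftrightarrow> p z / 2 + 1 / real n + 1 = 0) \<and> (shrinking l \<longleftrightarrow> p z / 2 + 1 / real n + 1 > 0)"
  proof
    fix z assume "z \<in> points M"
    then have "2 * l - (p z + 2 / real n) = 2" using M2(1) assms(12) by (simp add: soliton_scalar_def)
    then have "l = p z / 2 + 1 / real n + 1" by (simp add: field_simps)
    then show "(expanding l \<longleftrightarrow> p z / 2 + 1 / real n + 1 < 0)
        \<and> (steady l \<longleftrightarrow> p z / 2 + 1 / real n + 1 = 0) \<and> (shrinking l \<longleftrightarrow> p z / 2 + 1 / real n + 1 > 0)"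
      by (simp add: expanding_def steady_def shrinking_def)
  qed
qed

end
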